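(* Let $i\colon\mathsf{FinSet}\hookrightarrow\mathsf{Set}$ be the inclusion and let $\mathscr{P}^{\mathsf{f}}$ be the covariant powerset monad on $\mathsf{FinSet}$. The pushforward monad $i_\#\mathscr{P}^{\mathsf{f}}$ on $\mathsf{Set}$ is isomorphic (as a monad) to the filter monad.
   Context: The pushforward $i_\#T$ of a monad $T$ on $\mathsf{FinSet}$ is the right Kan extension $(i_\#T,\varepsilon\colon(i_\#T)i\to iT)$ of $iT$ along $i$ (which always exists), with the unique monad structure such that $\varepsilon\cdot\eta^{i_\#T}i=i\eta^T$ and $\varepsilon\cdot\mu^{i_\#T}i=i\mu^T\cdot\varepsilon T\cdot(i_\#T)\varepsilon$. $\mathscr{P}^{\mathsf{f}}$ is the restriction to finite sets of the covariant powerset monad $\mathscr{P}$ on $\mathsf{Set}$ (functions act by direct image; unit $x\mapsto\{x\}$; multiplication is union). A filter on a set $X$ is a subset $\mathscr{F}\subseteq\mathscr{P}X$ with $X\in\mathscr{F}$ and such that, for $A,B\subseteq X$, $A\cap B\in\mathscr{F}$ iff $A,B\in\mathscr{F}$ (the improper filter $\mathscr{P}X$ is allowed). The filter monad $F$ on $\mathsf{Set}$: $FX$ is the set of filters on $X$; for $f\colon X\to Y$, $Ff(\mathscr{F})=\{B\subseteq Y\mid f^{-1}B\in\mathscr{F}\}$; the unit sends $x$ to $\{B\subseteq X\mid x\in B\}$; the multiplication is $\mu^F_X(\mathfrak{F})=\{A\subseteq X\mid A^\#\in\mathfrak{F}\}$, where $A^\#=\{\mathscr{F}\in FX\mid A\in\mathscr{F}\}$.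 *)

theory Defs
  imports Main "HOL-Library.FuncSet"
begin

section \<open>Categories, functors and natural transformations\<close>

record ('o, 'm) cat =
  Obj :: "'o set"
  Arr :: "'m set"
  Dom :: "'m \<Rightarrow> 'o"
  Cod :: "'m \<Rightarrow> 'o"
  Ident :: "'o \<Rightarrow> 'm"
  Comp :: "'m \<Rightarrow> 'm \<Rightarrow> 'm" (infixr "\<cdot>\<index>" 70)

definition hom_set :: "('o, 'm) cat \<Rightarrow> 'o \<Rightarrow> 'o \<Rightarrow> 'm set" where
  "hom_set C X Y = {f \<in> Arr C. Dom C f = X \<and> Cod C f = Y}"

locale category =
  fixes C :: "('o, 'm) cat" (structure)
  assumes dom_obj: "f \<in> Arr C \<Longrightarrow> Dom C f \<in> Obj C"
    and cod_obj: "f \<in> Arr C \<Longrightarrow> Cod C f \<in> Obj C"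
    and ident_hom: "X \<in> Obj C \<Longrightarrow> Ident C X \<in> hom_set C X X"
    and comp_hom: "f \<in> hom_set C X Y \<Longrightarrow> g \<in> hom_set C Y Z \<Longrightarrow> g \<cdot> f \<in> hom_set C X Z"
    and comp_ident: "f \<in> hom_set C X Y \<Longrightarrow> f \<cdot> Ident C X = f"
    and ident_comp: "f \<in> hom_set C X Y \<Longrightarrow> Ident C Y \<cdot> f = f"
    and comp_assoc: "f \<in> hom_set C W X \<Longrightarrow> g \<in> hom_set C X Y \<Longrightarrow> h \<in> hom_set C Y Z
      \<Longrightarrow> (h \<cdot> g) \<cdot> f = h \<cdot> (g \<cdot> f)"

definition iso_arrow :: "('o, 'm) cat \<Rightarrow> 'm \<Rightarrow> bool" where
  "iso_arrow C f \<longleftrightarrow> f \<in> Arr C \<and> (\<exists>g \<in> hom_set C (Cod C f) (Dom C f).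
     g \<cdot>\<^bsub>C\<^esub> f = Ident C (Dom C f) \<and> f \<cdot>\<^bsub>C\<^esub> g = Ident C (Cod C f))"

text \<open>The values of functors and transformations outside the objects and arrows of the source
  category are irrelevant; hence all equations below are relativised to \<^const>\<open>Obj\<close> and
  \<^const>\<open>Arr\<close>.\<close>

record ('o, 'm, 'p, 'n) func =
  onObj :: "'o \<Rightarrow> 'p"
  onArr :: "'m \<Rightarrow> 'n"

locale is_functor = source: category C + target: category D
  for C :: "('o, 'm) cat" and D :: "('p, 'n) cat" +
  fixes F :: "('o, 'm, 'p, 'n) func"
  assumes obj: "X \<in> Obj C \<Longrightarrow> onObj F X \<in> Obj D"
    and arr: "f \<in> hom_set C X Y \<Longrightarrow> onArr F f \<in> hom_set D (onObj F X) (onObj F Y)"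
    and ident: "X \<in> Obj C \<Longrightarrow> onArr F (Ident C X) = Ident D (onObj F X)"
    and comp: "f \<in> hom_set C X Y \<Longrightarrow> g \<in> hom_set C Y Z
      \<Longrightarrow> onArr F (g \<cdot>\<^bsub>C\<^esub> f) = onArr F g \<cdot>\<^bsub>D\<^esub> onArr F f"

definition id_func :: "('o, 'm, 'o, 'm) func" where
  "id_func = \<lparr>onObj = (\<lambda>X. X), onArr = (\<lambda>f. f)\<rparr>"

definition comp_func ::
    "('p, 'n, 'q, 'k) func \<Rightarrow> ('o, 'm, 'p, 'n) func \<Rightarrow> ('o, 'm, 'q, 'k) func"
    (infixr "\<circ>\<^sub>F" 75) where
  "G \<circ>\<^sub>F F = \<lparr>onObj = (\<lambda>X. onObj G (onObj F X)), onArr = (\<lambda>f. onArr G (onArr F f))\<rparr>"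

locale nat_trans = source: is_functor C D F + target: is_functor C D G
  for C :: "('o, 'm) cat" and D :: "('p, 'n) cat" and F G +
  fixes \<tau> :: "'o \<Rightarrow> 'n"
  assumes component: "X \<in> Obj C \<Longrightarrow> \<tau> X \<in> hom_set D (onObj F X) (onObj G X)"
    and naturality: "f \<in> hom_set C X Y \<Longrightarrow> onArr G f \<cdot>\<^bsub>D\<^esub> \<tau> X = \<tau> Y \<cdot>\<^bsub>D\<^esub> onArr F f"

text \<open>\<open>(R, \<epsilon> : R K \<rightarrow> F)\<close> is a right Kan extension of \<open>F : C \<rightarrow> E\<close> along \<open>K : C \<rightarrow> D\<close>.\<close>

definition right_kan_extension ::
    "('o, 'm) cat \<Rightarrow> ('p, 'n) cat \<Rightarrow> ('q, 'k) cat \<Rightarrow> ('o, 'm, 'p, 'n) func \<Rightarrow>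
     ('o, 'm, 'q, 'k) func \<Rightarrow> ('p, 'n, 'q, 'k) func \<Rightarrow> ('o \<Rightarrow> 'k) \<Rightarrow> bool" where
  "right_kan_extension C D E K F R \<epsilon> \<longleftrightarrow>
     is_functor C D K \<and> is_functor C E F \<and> is_functor D E R \<and> nat_trans C E (R \<circ>\<^sub>F K) F \<epsilon> \<and>
     (\<forall>G \<alpha>. is_functor D E G \<and> nat_trans C E (G \<circ>\<^sub>F K) F \<alpha> \<longrightarrow>
       (\<exists>\<beta>. nat_trans D E G R \<beta> \<and> (\<forall>X \<in> Obj C. \<epsilon> X \<cdot>\<^bsub>E\<^esub> \<beta> (onObj K X) = \<alpha> X) \<and>
         (\<forall>\<beta>'. nat_trans D E G R \<beta>' \<and> (\<forall>X \<in> Obj C. \<epsilon> X \<cdot>\<^bsub>E\<^esub> \<beta>' (onObj K X) = \<alpha> X) \<longrightarrow>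
           (\<forall>Y \<in> Obj D. \<beta>' Y = \<beta> Y))))"


section \<open>Monads and pushforwards\<close>

record ('o, 'm) monad_data =
  Fun :: "('o, 'm, 'o, 'm) func"
  unit :: "'o \<Rightarrow> 'm"
  mult :: "'o \<Rightarrow> 'm"

locale monad =
  unit: nat_trans C C id_func "Fun T" "unit T" +
  mult: nat_trans C C "Fun T \<circ>\<^sub>F Fun T" "Fun T" "mult T"
  for C :: "('o, 'm) cat" (structure) and T :: "('o, 'm) monad_data" +
  assumes assoc: "X \<in> Obj C \<Longrightarrow>
      mult T X \<cdot> onArr (Fun T) (mult T X) = mult T X \<cdot> mult T (onObj (Fun T) X)"
    and unit_left: "X \<in> Obj C \<Longrightarrow>
      mult T X \<cdot> unit T (onObj (Fun T) X) = Ident C (onObj (Fun T) X)"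
    and unit_right: "X \<in> Obj C \<Longrightarrow>
      mult T X \<cdot> onArr (Fun T) (unit T X) = Ident C (onObj (Fun T) X)"

locale monad_morphism =
  source: monad C S + target: monad C T + nat_trans C C "Fun S" "Fun T" \<theta>
  for C :: "('o, 'm) cat" (structure) and S T \<theta> +
  assumes unit: "X \<in> Obj C \<Longrightarrow> \<theta> X \<cdot> unit S X = unit T X"
    and mult: "X \<in> Obj C \<Longrightarrow>
      \<theta> X \<cdot> mult S X = mult T X \<cdot> onArr (Fun T) (\<theta> X) \<cdot> \<theta> (onObj (Fun S) X)"

definition monads_isomorphic ::
    "('o, 'm) cat \<Rightarrow> ('o, 'm) monad_data \<Rightarrow> ('o, 'm) monad_data \<Rightarrow> bool" where
  "monads_isomorphic C S T \<longleftrightarrow>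
     (\<exists>\<theta>. monad_morphism C S T \<theta> \<and> (\<forall>X \<in> Obj C. iso_arrow C (\<theta> X)))"

text \<open>\<open>R\<close>, with counit \<open>\<epsilon>\<close>, is a pushforward \<open>K\<^sub># T\<close> of the monad \<open>T\<close> on \<open>C\<close> along
  \<open>K : C \<rightarrow> D\<close>. Kan extensions are determined only up to isomorphism, hence a predicate.\<close>

definition pushforward ::
    "('o, 'm) cat \<Rightarrow> ('p, 'n) cat \<Rightarrow> ('o, 'm, 'p, 'n) func \<Rightarrow> ('o, 'm) monad_data \<Rightarrow>
     ('p, 'n) monad_data \<Rightarrow> ('o \<Rightarrow> 'n) \<Rightarrow> bool" where
  "pushforward C D K T R \<epsilon> \<longleftrightarrow>
     monad C T \<and> right_kan_extension C D D K (K \<circ>\<^sub>F Fun T) (Fun R) \<epsilon> \<and> monad D R \<and>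
     (\<forall>X \<in> Obj C. \<epsilon> X \<cdot>\<^bsub>D\<^esub> unit R (onObj K X) = onArr K (unit T X)) \<and>
     (\<forall>X \<in> Obj C. \<epsilon> X \<cdot>\<^bsub>D\<^esub> mult R (onObj K X) =
        onArr K (mult T X) \<cdot>\<^bsub>D\<^esub> \<epsilon> (onObj (Fun T) X) \<cdot>\<^bsub>D\<^esub> onArr (Fun R) (\<epsilon> X))"


section \<open>The category of sets and its subcategory of finite sets\<close>

text \<open>HOL has no type of all sets, so the sets are taken from an arbitrary universe: a type whose
  elements \<open>x\<close> denote sets \<open>elts x\<close> of elements of the same type, satisfying the axioms of
  extensionality, (second-order) separation, union, power set and replacement. Pairing follows from
  these, and choice holds in HOL. Foundation and infinity are not required: the hereditarily finite
  sets are allowed, as is every Grothendieck universe with infinite sets.\<close>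

class universe =
  fixes elts :: "'a \<Rightarrow> 'a set"
  assumes extensionality: "elts x = elts y \<Longrightarrow> x = y"
    and separation: "A \<subseteq> elts x \<Longrightarrow> A \<in> range elts"
    and union: "(\<Union>y \<in> elts x. elts y) \<in> range elts"
    and power_set: "{y. elts y \<subseteq> elts x} \<in> range elts"
    and replacement: "f ` elts x \<in> range elts"

text \<open>The element denoting the set \<open>A\<close>; meaningful only for \<open>A \<in> range elts\<close>.\<close>

definition code :: "'v::universe set \<Rightarrow> 'v" where
  "code A = (THE x. elts x = A)"

datatype 'v setmap = Setmap (src: 'v) (tgt: 'v) (app: "'v \<Rightarrow> 'v")

definition mk_map :: "'v::universe \<Rightarrow> 'v \<Rightarrow> ('v \<Rightarrow> 'v) \<Rightarrow> 'v setmap" where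
  "mk_map X Y f = Setmap X Y (restrict f (elts X))"

definition SET :: "('v::universe, 'v setmap) cat" where
  "SET = \<lparr>Obj = UNIV,
          Arr = {f. app f \<in> elts (src f) \<rightarrow>\<^sub>E elts (tgt f)},
          Dom = src, Cod = tgt,
          Ident = (\<lambda>X. mk_map X X (\<lambda>x. x)),
          Comp = (\<lambda>g f. mk_map (src f) (tgt g) (\<lambda>x. app g (app f x)))\<rparr>"

definition FINSET :: "('v::universe, 'v setmap) cat" where
  "FINSET = SET\<lparr>Obj := {X. finite (elts X)},
                Arr := {f \<in> Arr SET. finite (elts (src f)) \<and> finite (elts (tgt f))}\<rparr>"

definition fin_inclusion :: "('v::universe, 'v setmap, 'v, 'v setmap) func" where
  "fin_inclusion = \<lparr>onObj = (\<lambda>X. X), onArr = (\<lambda>f. f)\<rparr>"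


section \<open>The powerset monad\<close>

definition pow_obj :: "'v::universe \<Rightarrow> 'v" where
  "pow_obj X = code {A. elts A \<subseteq> elts X}"

text \<open>Since \<^const>\<open>FINSET\<close> is a full subcategory closed under power sets, the following data
  describe the powerset monad on \<^const>\<open>SET\<close> as well as its restriction to \<^const>\<open>FINSET\<close>.\<close>

definition powerset_monad :: "('v::universe, 'v setmap) monad_data" where
  "powerset_monad =
    \<lparr>Fun = \<lparr>onObj = pow_obj,
            onArr = (\<lambda>f. mk_map (pow_obj (src f)) (pow_obj (tgt f)) (\<lambda>A. code (app f ` elts A)))\<rparr>,
     unit = (\<lambda>X. mk_map X (pow_obj X) (\<lambda>x. code {x})),
     mult = (\<lambda>X. mk_map (pow_obj (pow_obj X)) (pow_obj X) (\<lambda>\<A>. code (\<Union>A \<in> elts \<A>. elts A)))\<rparr>"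


section \<open>The filter monad\<close>

text \<open>Unlike \<open>'a filter\<close> of the library, these are filters on an arbitrary set.\<close>

definition filter_on :: "'a set \<Rightarrow> 'a set set \<Rightarrow> bool" where
  "filter_on X \<F> \<longleftrightarrow> \<F> \<subseteq> Pow X \<and> X \<in> \<F> \<and>
     (\<forall>A B. A \<subseteq> X \<and> B \<subseteq> X \<longrightarrow> (A \<inter> B \<in> \<F> \<longleftrightarrow> A \<in> \<F> \<and> B \<in> \<F>))"

definition filter_obj :: "'v::universe \<Rightarrow> 'v" where
  "filter_obj X = code {\<F>. filter_on (elts X) (elts ` elts \<F>)}"

definition filter_map :: "'v::universe setmap \<Rightarrow> 'v setmap" where
  "filter_map f = mk_map (filter_obj (src f)) (filter_obj (tgt f))
     (\<lambda>\<F>. code {B. elts B \<subseteq> elts (tgt f) \<and> code {x \<in> elts (src f). app f x \<in> elts B} \<in> elts \<F>})"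

definition filter_unit :: "'v::universe \<Rightarrow> 'v setmap" where
  "filter_unit X = mk_map X (filter_obj X) (\<lambda>x. code {B. elts B \<subseteq> elts X \<and> x \<in> elts B})"

definition sharp :: "'v::universe \<Rightarrow> 'v \<Rightarrow> 'v" where
  "sharp X A = code {\<F> \<in> elts (filter_obj X). A \<in> elts \<F>}"

definition filter_mult :: "'v::universe \<Rightarrow> 'v setmap" where
  "filter_mult X = mk_map (filter_obj (filter_obj X)) (filter_obj X)
     (\<lambda>\<Phi>. code {A. elts A \<subseteq> elts X \<and> sharp X A \<in> elts \<Phi>})"

definition filter_monad :: "('v::universe, 'v setmap) monad_data" where
  "filter_monad = \<lparr>Fun = \<lparr>onObj = filter_obj, onArr = filter_map\<rparr>,
                   unit = filter_unit, mult = filter_mult\<rparr>"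

end

(* The category-theoretic half is that a pushforward is unique up to isomorphism of monads: the
   comparison of two Kan extensions respects units and multiplications because both sides of each
   equation have the same composite with the counit. It then remains to see that the filter monad
   is a pushforward. The counit sends a filter on a finite set to its core, the intersection of its
   members, which determines it: B belongs to the filter iff B contains the core. Given a functor G
   with a transformation alpha : G i -> i P, the comparison map sends t in G X to the set of those A
   for which alpha_2 (G chi_A t) is contained in {true}. By naturality of alpha, for f : X -> Y with
   Y finite the set f^{-1} B belongs to it iff alpha_Y (G f t) is contained in B; the filter axioms,
   the naturality and the factorisation all follow from this. *)

theory Submission
  imports Defs
begin

section \<open>Uniqueness of pushforwards\<close>

text \<open>The limit formula would present an element of the Kan extension at X as a compatible
  family of subsets, one of Y for every map X -> Y into a finite set Y. A filter on X encodes such a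
  family: to f it assigns the core of its image along f. A filter on an infinite set need not be
  generated by its own core, but each of its images in a finite set is; this is why filters and not
  just subsets appear. The maps into the two-element set already determine the family, which is
  where chi_A comes from. Closure under intersections is the obstacle: A and B are tested by two
  different maps out of X, and alpha is natural only for maps between finite sets. The remedy is a
  single map from X to the four-element set P(2) that has both A and B as inverse images. The
  universal property is checked directly on elements, without forming the limit.\<close>

lemma hom_setD:
  assumes "f \<in> hom_set C X Y"
  shows "f \<in> Arr C" "Dom C f = X" "Cod C f = Y"
  using assms by (auto simp: hom_set_def)

lemma comp_func_simps [simp]:
  "onObj (G \<circ>\<^sub>F F) X = onObj G (onObj F X)"
  "onArr (G \<circ>\<^sub>F F) f = onArr G (onArr F f)"
  by (simp_all add: comp_func_def)

lemma id_func_simps [simp]: "onObj id_func X = X" "onArr id_func f = f"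
  by (simp_all add: id_func_def)

section \<open>Composition and whiskering of natural transformations\<close>

lemma is_functor_id: "category C \<Longrightarrow> is_functor C C id_func"
  by (simp add: is_functor_def is_functor_axioms_def)

lemma is_functor_comp:
  assumes "is_functor C D F" "is_functor D E G"
  shows "is_functor C E (G \<circ>\<^sub>F F)"
proof -
  interpret F: is_functor C D F by fact
  interpret G: is_functor D E G by fact
  show ?thesis
    by unfold_locales
      (auto simp: F.obj F.ident F.comp G.obj G.ident intro!: G.arr F.arr G.comp)
qed

lemma nat_trans_ident:
  assumes "is_functor C D F"
  shows "nat_trans C D F F (\<lambda>X. Ident D (onObj F X))"
proof -
  interpret F: is_functor C D F by fact
  show ?thesis
    by unfold_locales
      (auto simp: F.obj F.target.ident_hom F.target.comp_ident[OF F.arr]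
        F.target.ident_comp[OF F.arr])
qed

lemma nat_trans_comp:
  assumes "nat_trans C D F G \<sigma>" "nat_trans C D G H \<tau>"
  shows "nat_trans C D F H (\<lambda>X. \<tau> X \<cdot>\<^bsub>D\<^esub> \<sigma> X)"
proof -
  interpret s: nat_trans C D F G \<sigma> by fact
  interpret t: nat_trans C D G H \<tau> by fact
  note assoc = s.source.target.comp_assoc
  show ?thesis
  proof unfold_locales
    fix X assume "X \<in> Obj C"
    then show "\<tau> X \<cdot>\<^bsub>D\<^esub> \<sigma> X \<in> hom_set D (onObj F X) (onObj H X)"
      by (meson s.component t.component s.source.target.comp_hom)
  next
    fix f X Y assume f: "f \<in> hom_set C X Y"
    then have X: "X \<in> Obj C" and Y: "Y \<in> Obj C"
      using s.source.source.dom_obj s.source.source.cod_obj by (auto simp: hom_set_def)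
    have "onArr H f \<cdot>\<^bsub>D\<^esub> \<tau> X \<cdot>\<^bsub>D\<^esub> \<sigma> X = (onArr H f \<cdot>\<^bsub>D\<^esub> \<tau> X) \<cdot>\<^bsub>D\<^esub> \<sigma> X"
      using assoc[OF s.component[OF X] t.component[OF X] t.target.arr[OF f]] by simp
    also have "\<dots> = \<tau> Y \<cdot>\<^bsub>D\<^esub> onArr G f \<cdot>\<^bsub>D\<^esub> \<sigma> X"
      using assoc[OF s.component[OF X] s.target.arr[OF f] t.component[OF Y]]
      by (simp add: t.naturality[OF f])
    also have "\<dots> = (\<tau> Y \<cdot>\<^bsub>D\<^esub> \<sigma> Y) \<cdot>\<^bsub>D\<^esub> onArr F f"
      using assoc[OF s.source.arr[OF f] s.component[OF Y] t.component[OF Y]]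
      by (simp add: s.naturality[OF f])
    finally show "onArr H f \<cdot>\<^bsub>D\<^esub> \<tau> X \<cdot>\<^bsub>D\<^esub> \<sigma> X = (\<tau> Y \<cdot>\<^bsub>D\<^esub> \<sigma> Y) \<cdot>\<^bsub>D\<^esub> onArr F f" .
  qed
qed

lemma nat_trans_whisker_right:
  assumes "is_functor B C K" "nat_trans C D F G \<tau>"
  shows "nat_trans B D (F \<circ>\<^sub>F K) (G \<circ>\<^sub>F K) (\<lambda>X. \<tau> (onObj K X))"
proof -
  interpret K: is_functor B C K by fact
  interpret t: nat_trans C D F G \<tau> by fact
  interpret FK: is_functor B D "F \<circ>\<^sub>F K"
    by (rule is_functor_comp[OF K.is_functor_axioms t.source.is_functor_axioms])
  interpret GK: is_functor B D "G \<circ>\<^sub>F K"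
    by (rule is_functor_comp[OF K.is_functor_axioms t.target.is_functor_axioms])
  show ?thesis
    by unfold_locales (auto simp: t.component K.obj intro!: t.naturality K.arr)
qed

lemma nat_trans_whisker_left:
  assumes "nat_trans C D F G \<tau>" "is_functor D E H"
  shows "nat_trans C E (H \<circ>\<^sub>F F) (H \<circ>\<^sub>F G) (\<lambda>X. onArr H (\<tau> X))"
proof -
  interpret H: is_functor D E H by fact
  interpret t: nat_trans C D F G \<tau> by fact
  interpret HF: is_functor C E "H \<circ>\<^sub>F F"
    by (rule is_functor_comp[OF t.source.is_functor_axioms H.is_functor_axioms])
  interpret HG: is_functor C E "H \<circ>\<^sub>F G"
    by (rule is_functor_comp[OF t.target.is_functor_axioms H.is_functor_axioms])
  show ?thesis
  proof unfold_locales
    fix X assume "X \<in> Obj C"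
    then show "onArr H (\<tau> X) \<in> hom_set E (onObj (H \<circ>\<^sub>F F) X) (onObj (H \<circ>\<^sub>F G) X)"
      by (simp add: H.arr t.component)
  next
    fix f X Y assume f: "f \<in> hom_set C X Y"
    then have X: "X \<in> Obj C" and Y: "Y \<in> Obj C"
      using t.source.source.dom_obj t.source.source.cod_obj by (auto simp: hom_set_def)
    show "onArr (H \<circ>\<^sub>F G) f \<cdot>\<^bsub>E\<^esub> onArr H (\<tau> X) = onArr H (\<tau> Y) \<cdot>\<^bsub>E\<^esub> onArr (H \<circ>\<^sub>F F) f"
      using H.comp[OF t.component[OF X] t.target.arr[OF f]]
        H.comp[OF t.source.arr[OF f] t.component[OF Y]]
      by (simp add: t.naturality[OF f])
  qed
qed

text \<open>Both transformations factor the same \<open>\<alpha>\<close>, the composite of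
  \<open>\<epsilon>\<close> with \<open>\<beta>\<close> whiskered along \<open>K\<close>. It is
  natural because whiskering and vertical composition preserve naturality, so uniqueness of the
  factorisation identifies the two.\<close>

lemma right_kan_extension_eqI:
  assumes R: "right_kan_extension C D E K F R \<epsilon>"
    and \<beta>: "nat_trans D E G R \<beta>" and \<beta>': "nat_trans D E G R \<beta>'"
    and eq: "\<And>X. X \<in> Obj C \<Longrightarrow> \<epsilon> X \<cdot>\<^bsub>E\<^esub> \<beta> (onObj K X) = \<epsilon> X \<cdot>\<^bsub>E\<^esub> \<beta>' (onObj K X)"
    and Y: "Y \<in> Obj D"
  shows "\<beta> Y = \<beta>' Y"
proof -
  let ?\<alpha> = "\<lambda>X. \<epsilon> X \<cdot>\<^bsub>E\<^esub> \<beta> (onObj K X)"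
  have K: "is_functor C D K" and \<epsilon>: "nat_trans C E (R \<circ>\<^sub>F K) F \<epsilon>"
    using R by (auto simp: right_kan_extension_def)
  have "nat_trans C E (G \<circ>\<^sub>F K) F ?\<alpha>"
    by (rule nat_trans_comp[OF nat_trans_whisker_right[OF K \<beta>] \<epsilon>])
  moreover have "is_functor D E G"
    using \<beta> by (rule nat_trans.axioms)
  ultimately obtain \<gamma> where "\<And>\<beta>'. nat_trans D E G R \<beta>' \<Longrightarrow>
      (\<forall>X \<in> Obj C. \<epsilon> X \<cdot>\<^bsub>E\<^esub> \<beta>' (onObj K X) = ?\<alpha> X) \<Longrightarrow> \<forall>Y \<in> Obj D. \<beta>' Y = \<gamma> Y"
    using R unfolding right_kan_extension_def by blast
  from this[OF \<beta>] this[OF \<beta>'] eq Y show ?thesis by auto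
qed

lemma right_kan_extension_factor:
  assumes "right_kan_extension C D E K F R \<epsilon>" "is_functor D E G"
    "nat_trans C E (G \<circ>\<^sub>F K) F \<alpha>"
  obtains \<beta> where "nat_trans D E G R \<beta>"
    "\<And>X. X \<in> Obj C \<Longrightarrow> \<epsilon> X \<cdot>\<^bsub>E\<^esub> \<beta> (onObj K X) = \<alpha> X"
  using assms unfolding right_kan_extension_def by blast

text \<open>The composite of \<open>\<theta>\<close> and \<open>\<theta>'\<close> and the identity
  both leave \<open>\<epsilon>\<close> unchanged, so \<open>right_kan_extension_eqI\<close> applies.
  A second use with the roles exchanged gives the other inverse law.\<close>

lemma right_kan_extension_mutual_inverse:
  assumes R: "right_kan_extension C D E K F R \<epsilon>"
    and \<theta>: "nat_trans D E R S \<theta>" "\<And>X. X \<in> Obj C \<Longrightarrow> \<delta> X \<cdot>\<^bsub>E\<^esub> \<theta> (onObj K X) = \<epsilon> X"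
    and \<theta>': "nat_trans D E S R \<theta>'" "\<And>X. X \<in> Obj C \<Longrightarrow> \<epsilon> X \<cdot>\<^bsub>E\<^esub> \<theta>' (onObj K X) = \<delta> X"
    and Y: "Y \<in> Obj D"
  shows "\<theta>' Y \<cdot>\<^bsub>E\<^esub> \<theta> Y = Ident E (onObj R Y)"
proof -
  interpret E: category E
    using R by (simp add: right_kan_extension_def is_functor_def)
  interpret \<epsilon>: nat_trans C E "R \<circ>\<^sub>F K" F \<epsilon>
    using R by (simp add: right_kan_extension_def)
  interpret K: is_functor C D K
    using R by (simp add: right_kan_extension_def)
  interpret \<theta>: nat_trans D E R S \<theta> by fact
  interpret \<theta>': nat_trans D E S R \<theta>' by fact
  show ?thesis
  proof (rule right_kan_extension_eqI[OF R nat_trans_comp[OF \<theta>(1) \<theta>'(1)] nat_trans_ident _ Y])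
    show "is_functor D E R" by unfold_locales
    fix X assume X: "X \<in> Obj C"
    have "\<epsilon> X \<cdot>\<^bsub>E\<^esub> \<theta>' (onObj K X) \<cdot>\<^bsub>E\<^esub> \<theta> (onObj K X) = (\<epsilon> X \<cdot>\<^bsub>E\<^esub> \<theta>' (onObj K X)) \<cdot>\<^bsub>E\<^esub> \<theta> (onObj K X)"
      using E.comp_assoc[OF \<theta>.component \<theta>'.component] K.obj[OF X] \<epsilon>.component[OF X] by simp
    also have "\<dots> = \<epsilon> X \<cdot>\<^bsub>E\<^esub> Ident E (onObj R (onObj K X))"
      using E.comp_ident \<epsilon>.component[OF X] X by (simp add: \<theta>(2) \<theta>'(2))
    finally show "\<epsilon> X \<cdot>\<^bsub>E\<^esub> \<theta>' (onObj K X) \<cdot>\<^bsub>E\<^esub> \<theta> (onObj K X) =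
        \<epsilon> X \<cdot>\<^bsub>E\<^esub> Ident E (onObj R (onObj K X))" .
  qed
qed

theorem pushforward_unique:
  assumes R: "pushforward C D K T R \<epsilon>" and S: "pushforward C D K T S \<delta>"
  shows "monads_isomorphic D R S"
proof -
  have RK: "right_kan_extension C D D K (K \<circ>\<^sub>F Fun T) (Fun R) \<epsilon>"
    and SK: "right_kan_extension C D D K (K \<circ>\<^sub>F Fun T) (Fun S) \<delta>"
    using R S by (auto simp: pushforward_def)
  interpret D: category D
    using RK by (simp add: right_kan_extension_def is_functor_def)
  interpret T: monad C T using R by (simp add: pushforward_def)
  interpret R: monad D R using R by (simp add: pushforward_def)
  interpret S: monad D S using S by (simp add: pushforward_def)
  interpret \<epsilon>: nat_trans C D "Fun R \<circ>\<^sub>F K" "K \<circ>\<^sub>F Fun T" \<epsilon>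
    using RK by (simp add: right_kan_extension_def)
  interpret \<delta>: nat_trans C D "Fun S \<circ>\<^sub>F K" "K \<circ>\<^sub>F Fun T" \<delta>
    using SK by (simp add: right_kan_extension_def)
  interpret K: is_functor C D K
    using RK by (simp add: right_kan_extension_def)
  note Rf = R.unit.target.is_functor_axioms and Sf = S.unit.target.is_functor_axioms
  note assoc = D.comp_assoc and hom = D.comp_hom
  \<comment> \<open>\<open>\<theta>\<close> factors \<open>\<epsilon>\<close> through
    \<open>\<delta>\<close>. The monad morphism equations for it take values in
    \<open>Fun S\<close>, hence both are tested against \<open>\<delta>\<close>. The inverse comes
    from the opposite factorisation.\<close>
  obtain \<theta> where \<theta>: "nat_trans D D (Fun R) (Fun S) \<theta>"
      "\<And>X. X \<in> Obj C \<Longrightarrow> \<delta> X \<cdot>\<^bsub>D\<^esub> \<theta> (onObj K X) = \<epsilon> X"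
    using right_kan_extension_factor[OF SK Rf \<epsilon>.nat_trans_axioms] by blast
  obtain \<theta>' where \<theta>': "nat_trans D D (Fun S) (Fun R) \<theta>'"
      "\<And>X. X \<in> Obj C \<Longrightarrow> \<epsilon> X \<cdot>\<^bsub>D\<^esub> \<theta>' (onObj K X) = \<delta> X"
    using right_kan_extension_factor[OF RK Sf \<delta>.nat_trans_axioms] by blast
  interpret \<theta>: nat_trans D D "Fun R" "Fun S" \<theta> by fact
  interpret \<theta>': nat_trans D D "Fun S" "Fun R" \<theta>' by fact
  have \<epsilon>_hom: "\<epsilon> X \<in> hom_set D (onObj (Fun R) (onObj K X)) (onObj K (onObj (Fun T) X))"
    and \<delta>_hom: "\<delta> X \<in> hom_set D (onObj (Fun S) (onObj K X)) (onObj K (onObj (Fun T) X))"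
    if "X \<in> Obj C" for X
    using \<epsilon>.component[OF that] \<delta>.component[OF that] by simp_all
  have unitR: "unit R Y \<in> hom_set D Y (onObj (Fun R) Y)"
    and multR: "mult R Y \<in> hom_set D (onObj (Fun R) (onObj (Fun R) Y)) (onObj (Fun R) Y)"
    and multS: "mult S Y \<in> hom_set D (onObj (Fun S) (onObj (Fun S) Y)) (onObj (Fun S) Y)"
    if "Y \<in> Obj D" for Y
    using R.unit.component[OF that] R.mult.component[OF that] S.mult.component[OF that] by simp_all
  have unit: "\<theta> Y \<cdot>\<^bsub>D\<^esub> unit R Y = unit S Y" if Y: "Y \<in> Obj D" for Y
  proof (rule right_kan_extension_eqI[OF SK _ _ _ Y])
    show "nat_trans D D id_func (Fun S) (\<lambda>Y. \<theta> Y \<cdot>\<^bsub>D\<^esub> unit R Y)"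
      by (rule nat_trans_comp) unfold_locales
    show "nat_trans D D id_func (Fun S) (unit S)" by unfold_locales
    fix X assume X: "X \<in> Obj C"
    show "\<delta> X \<cdot>\<^bsub>D\<^esub> \<theta> (onObj K X) \<cdot>\<^bsub>D\<^esub> unit R (onObj K X) = \<delta> X \<cdot>\<^bsub>D\<^esub> unit S (onObj K X)"
      using assoc[OF unitR \<theta>.component \<delta>_hom[OF X]] K.obj[OF X] X R S
      by (auto simp: \<theta>(2) pushforward_def)
  qed
  have mult: "\<theta> Y \<cdot>\<^bsub>D\<^esub> mult R Y = mult S Y \<cdot>\<^bsub>D\<^esub> onArr (Fun S) (\<theta> Y) \<cdot>\<^bsub>D\<^esub> \<theta> (onObj (Fun R) Y)"
    if Y: "Y \<in> Obj D" for Y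
  proof (rule right_kan_extension_eqI[OF SK _ _ _ Y])
    show "nat_trans D D (Fun R \<circ>\<^sub>F Fun R) (Fun S) (\<lambda>Y. \<theta> Y \<cdot>\<^bsub>D\<^esub> mult R Y)"
      by (rule nat_trans_comp) unfold_locales
    \<comment> \<open>This is \<open>mult S\<close> after the horizontal composite of
      \<open>\<theta>\<close> with itself, taken as a right whiskering followed by a left
      one.\<close>
    show "nat_trans D D (Fun R \<circ>\<^sub>F Fun R) (Fun S)
        (\<lambda>Y. mult S Y \<cdot>\<^bsub>D\<^esub> onArr (Fun S) (\<theta> Y) \<cdot>\<^bsub>D\<^esub> \<theta> (onObj (Fun R) Y))"
      by (rule nat_trans_comp[OF nat_trans_comp[OF nat_trans_whisker_right[OF Rf \<theta>(1)]
              nat_trans_whisker_left[OF \<theta>(1) Sf]] S.mult.nat_trans_axioms])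
    fix X assume X: "X \<in> Obj C"
    let ?KX = "onObj K X" and ?TX = "onObj (Fun T) X"
    have KX: "?KX \<in> Obj D" using X by (rule K.obj)
    have TX: "?TX \<in> Obj C" using X by (rule T.unit.target.obj)
    have \<theta>RK: "\<theta> (onObj (Fun R) ?KX) \<in> hom_set D
        (onObj (Fun R) (onObj (Fun R) ?KX)) (onObj (Fun S) (onObj (Fun R) ?KX))"
      by (intro \<theta>.component R.unit.target.obj KX)
    have S\<theta>: "onArr (Fun S) (\<theta> ?KX) \<in> hom_set D
        (onObj (Fun S) (onObj (Fun R) ?KX)) (onObj (Fun S) (onObj (Fun S) ?KX))"
      by (intro S.unit.target.arr \<theta>.component KX)
    have S\<delta>: "onArr (Fun S) (\<delta> X) \<in> hom_set D
        (onObj (Fun S) (onObj (Fun S) ?KX)) (onObj (Fun S) (onObj K ?TX))"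
      by (intro S.unit.target.arr \<delta>_hom X)
    have R\<epsilon>: "onArr (Fun R) (\<epsilon> X) \<in> hom_set D
        (onObj (Fun R) (onObj (Fun R) ?KX)) (onObj (Fun R) (onObj K ?TX))"
      by (intro R.unit.target.arr \<epsilon>_hom X)
    have \<theta>KT: "\<theta> (onObj K ?TX) \<in> hom_set D
        (onObj (Fun R) (onObj K ?TX)) (onObj (Fun S) (onObj K ?TX))"
      by (intro \<theta>.component K.obj TX)
    have K\<mu>: "onArr K (mult T X) \<in> hom_set D (onObj K (onObj (Fun T) ?TX)) (onObj K ?TX)"
      using T.mult.component[OF X] by (intro K.arr) simp
    \<comment> \<open>Brackets are moved so that \<open>onArr (Fun S) (\<delta> X)\<close> meets
      \<open>onArr (Fun S) (\<theta> ?KX)\<close>: together they are \<open>Fun S\<close> applied to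
      \<open>\<epsilon> X\<close>. Naturality of \<open>\<theta>\<close> at
      \<open>\<epsilon> X\<close> then puts \<open>\<theta>\<close> next to
      \<open>\<delta> ?TX\<close>, where the two contract to \<open>\<epsilon> ?TX\<close> and the
      counit equation for \<open>mult R\<close> applies.\<close>
    have "\<delta> X \<cdot>\<^bsub>D\<^esub> mult S ?KX \<cdot>\<^bsub>D\<^esub> onArr (Fun S) (\<theta> ?KX) \<cdot>\<^bsub>D\<^esub> \<theta> (onObj (Fun R) ?KX)
        = (\<delta> X \<cdot>\<^bsub>D\<^esub> mult S ?KX) \<cdot>\<^bsub>D\<^esub> onArr (Fun S) (\<theta> ?KX) \<cdot>\<^bsub>D\<^esub> \<theta> (onObj (Fun R) ?KX)"
      by (rule assoc[OF hom[OF \<theta>RK S\<theta>] multS[OF KX] \<delta>_hom[OF X], symmetric])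
    also have "\<delta> X \<cdot>\<^bsub>D\<^esub> mult S ?KX =
        (onArr K (mult T X) \<cdot>\<^bsub>D\<^esub> \<delta> ?TX) \<cdot>\<^bsub>D\<^esub> onArr (Fun S) (\<delta> X)"
      using S X by (simp add: pushforward_def assoc[OF S\<delta> \<delta>_hom[OF TX] K\<mu>])
    also have "\<dots> \<cdot>\<^bsub>D\<^esub> onArr (Fun S) (\<theta> ?KX) \<cdot>\<^bsub>D\<^esub> \<theta> (onObj (Fun R) ?KX) =
        (onArr K (mult T X) \<cdot>\<^bsub>D\<^esub> \<delta> ?TX) \<cdot>\<^bsub>D\<^esub>
          onArr (Fun S) (\<delta> X) \<cdot>\<^bsub>D\<^esub> onArr (Fun S) (\<theta> ?KX) \<cdot>\<^bsub>D\<^esub> \<theta> (onObj (Fun R) ?KX)"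
      by (rule assoc[OF hom[OF \<theta>RK S\<theta>] S\<delta> hom[OF \<delta>_hom[OF TX] K\<mu>]])
    also have "onArr (Fun S) (\<delta> X) \<cdot>\<^bsub>D\<^esub> onArr (Fun S) (\<theta> ?KX) \<cdot>\<^bsub>D\<^esub> \<theta> (onObj (Fun R) ?KX) =
        onArr (Fun S) (\<epsilon> X) \<cdot>\<^bsub>D\<^esub> \<theta> (onObj (Fun R) ?KX)"
      using assoc[OF \<theta>RK S\<theta> S\<delta>] S.unit.target.comp[OF \<theta>.component[OF KX] \<delta>_hom[OF X]] X
      by (simp add: \<theta>(2))
    also have "\<dots> = \<theta> (onObj K ?TX) \<cdot>\<^bsub>D\<^esub> onArr (Fun R) (\<epsilon> X)"
      by (rule \<theta>.naturality[OF \<epsilon>_hom[OF X]])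
    also have "(onArr K (mult T X) \<cdot>\<^bsub>D\<^esub> \<delta> ?TX) \<cdot>\<^bsub>D\<^esub> \<dots> =
        onArr K (mult T X) \<cdot>\<^bsub>D\<^esub> \<epsilon> ?TX \<cdot>\<^bsub>D\<^esub> onArr (Fun R) (\<epsilon> X)"
      using assoc[OF hom[OF R\<epsilon> \<theta>KT] \<delta>_hom[OF TX] K\<mu>] assoc[OF R\<epsilon> \<theta>KT \<delta>_hom[OF TX]]
      by (simp add: \<theta>(2)[OF TX])
    also have "\<dots> = \<epsilon> X \<cdot>\<^bsub>D\<^esub> mult R ?KX"
      using R X by (simp add: pushforward_def)
    also have "\<dots> = \<delta> X \<cdot>\<^bsub>D\<^esub> \<theta> ?KX \<cdot>\<^bsub>D\<^esub> mult R ?KX"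
      using assoc[OF multR[OF KX] \<theta>.component[OF KX] \<delta>_hom[OF X]] X by (simp add: \<theta>(2))
    finally show "\<delta> X \<cdot>\<^bsub>D\<^esub> \<theta> ?KX \<cdot>\<^bsub>D\<^esub> mult R ?KX =
      \<delta> X \<cdot>\<^bsub>D\<^esub> mult S ?KX \<cdot>\<^bsub>D\<^esub> onArr (Fun S) (\<theta> ?KX) \<cdot>\<^bsub>D\<^esub> \<theta> (onObj (Fun R) ?KX)" ..
  qed
  have "monad_morphism D R S \<theta>"
    by unfold_locales (fact unit, fact mult)
  moreover have "iso_arrow D (\<theta> Y)" if Y: "Y \<in> Obj D" for Y
    using right_kan_extension_mutual_inverse[OF RK \<theta> \<theta>' Y]
      right_kan_extension_mutual_inverse[OF SK \<theta>' \<theta> Y] \<theta>'.component[OF Y]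
      hom_setD[OF \<theta>.component[OF Y]]
    by (auto simp: iso_arrow_def)
  ultimately show ?thesis
    by (auto simp: monads_isomorphic_def)
qed

section \<open>Sets and the powerset monad\<close>

lemma elts_eq_iff: "elts x = elts y \<longleftrightarrow> x = y"
  using extensionality by auto

lemma code_elts [simp]: "code (elts x) = x"
  by (simp add: code_def elts_eq_iff)

lemma elts_code: "A \<in> range elts \<Longrightarrow> elts (code A) = A"
  by auto

lemma elts_code_subset: "A \<subseteq> elts x \<Longrightarrow> elts (code A) = A"
  by (rule elts_code[OF separation])

lemma elts_code_Collect [simp]: "elts (code {x \<in> elts X. P x}) = {x \<in> elts X. P x}"
  by (rule elts_code_subset) auto

lemma elts_code_Int [simp]: "elts (code (elts A \<inter> elts B)) = elts A \<inter> elts B"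
  by (rule elts_code_subset) auto

lemma elts_code_image [simp]:
  fixes f :: "'v::universe \<Rightarrow> 'v"
  shows "elts (code (f ` elts X)) = f ` elts X"
  by (rule elts_code[OF replacement])

lemma elts_code_UN [simp]: "elts (code (\<Union>A \<in> elts X. elts A)) = (\<Union>A \<in> elts X. elts A)"
  by (rule elts_code[OF union])

lemma elts_pow_obj [simp]: "elts (pow_obj X) = {A. elts A \<subseteq> elts X}"
  unfolding pow_obj_def by (rule elts_code[OF power_set])

lemma elts_code_subsets [simp]:
  "elts (code {A. elts A \<subseteq> elts X \<and> P A}) = {A. elts A \<subseteq> elts X \<and> P A}"
  using elts_code_Collect[of "pow_obj X" P] by simp

lemma empty_in_range_elts: "{} \<in> range elts"
  by (rule separation) simp

lemma elts_code_empty [simp]: "elts (code {}) = {}"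
  by (rule elts_code[OF empty_in_range_elts])

text \<open>Singletons come from replacement: a constant map is applied to the power set of the
  empty set, which is inhabited.\<close>

lemma elts_code_singleton [simp]: "elts (code {x}) = {x}" for x :: "'v::universe"
proof -
  have "\<exists>y :: 'v. elts y = {}"
    using elts_code_empty by blast
  then have "{x} = (\<lambda>_. x) ` elts (pow_obj (code {}) :: 'v)"
    by auto
  then show ?thesis by (metis elts_code_image)
qed

text \<open>Injectivity of \<open>elts\<close> bounds the coded subsets by the actual ones; this
  closes \<open>FINSET\<close> under \<open>pow_obj\<close>.\<close>

lemma finite_subsets [simp]: "finite S \<Longrightarrow> finite {A. elts A \<subseteq> S}"
  by (rule inj_on_finite[where f = elts and B = "Pow S"])
    (auto simp: inj_on_def elts_eq_iff)

text \<open>The ordinal 1, whose power set is the two-element set with \<open>code {}\<close> as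
  falsity. Both exist in every universe, even in that of the hereditarily finite sets.\<close>

definition truth :: "'v::universe" where "truth = code {code {}}"

definition truth_values :: "'v::universe" where "truth_values = pow_obj truth"

lemma elts_truth [simp]: "elts truth = {code {}}"
  by (simp add: truth_def)

lemma empty_neq_truth [simp]: "code {} \<noteq> truth"
  by (metis elts_code_empty elts_truth insert_not_empty)

lemma elts_truth_values [simp]: "elts truth_values = {code {}, truth}"
proof -
  have "elts S \<subseteq> {code {}} \<longleftrightarrow> S = code {} \<or> S = truth" for S :: 'a
    unfolding subset_singleton_iff using elts_code_empty elts_truth extensionality by metis
  then show ?thesis by (auto simp: truth_values_def)
qed

section \<open>Arrows between sets and between finite sets\<close>

lemma src_mk_map [simp]: "src (mk_map X Y f) = X"
  and tgt_mk_map [simp]: "tgt (mk_map X Y f) = Y"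
  and app_mk_map [simp]: "x \<in> elts X \<Longrightarrow> app (mk_map X Y f) x = f x"
  by (simp_all add: mk_map_def)

text \<open>As a congruence rule it provides \<open>x \<in> elts X\<close> while the body is
  simplified, the premise under which \<open>app_mk_map\<close> rewrites.\<close>

lemma mk_map_cong [cong]:
  assumes "X = X'" "Y = Y'" "\<And>x. x \<in> elts X' \<Longrightarrow> f x = g x"
  shows "mk_map X Y f = mk_map X' Y' g"
  using assms by (auto simp: mk_map_def intro: restrict_ext)

lemma image_mk_map [simp]: "A \<subseteq> elts X \<Longrightarrow> app (mk_map X Y f) ` A = f ` A"
  by (rule image_cong) auto

text \<open>Comparing elements of the values lets the \<open>elts (code _)\<close> rules remove the
  codes on both sides.\<close>

lemma mk_map_elts_eqI:
  assumes "\<And>x. x \<in> elts X \<Longrightarrow> elts (f x) = elts (g x)"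
  shows "mk_map X Y f = mk_map X Y g"
  using assms by (auto simp: elts_eq_iff)

lemma mk_map_eq_iff: "mk_map X Y f = mk_map X Y g \<longleftrightarrow> (\<forall>x \<in> elts X. f x = g x)"
  by (auto simp: mk_map_def restrict_def fun_eq_iff)

lemma mk_map_app:
  assumes "f \<in> Arr SET"
  shows "mk_map (src f) (tgt f) (app f) = f"
  using assms by (cases f) (auto simp: mk_map_def SET_def)

lemma Obj_SET [simp]: "Obj SET = UNIV"
  and Ident_SET [simp]: "Ident SET X = mk_map X X (\<lambda>x. x)"
  and Comp_SET [simp]: "g \<cdot>\<^bsub>SET\<^esub> f = mk_map (src f) (tgt g) (\<lambda>x. app g (app f x))"
  by (simp_all add: SET_def)

lemma hom_SET_iff:
  "f \<in> hom_set SET X Y \<longleftrightarrow> src f = X \<and> tgt f = Y \<and> app f \<in> elts X \<rightarrow>\<^sub>E elts Y"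
  by (auto simp: hom_set_def SET_def)

lemma hom_SETD:
  assumes "f \<in> hom_set SET X Y"
  shows "src f = X" "tgt f = Y" "x \<in> elts X \<Longrightarrow> app f x \<in> elts Y"
  using assms by (auto simp: hom_SET_iff)

lemma mk_map_hom:
  "(\<And>x. x \<in> elts X \<Longrightarrow> f x \<in> elts Y) \<Longrightarrow> mk_map X Y f \<in> hom_set SET X Y"
  by (auto simp: hom_SET_iff mk_map_def)

lemma hom_SET_mk_map:
  assumes "f \<in> hom_set SET X Y"
  shows "mk_map X Y (app f) = f"
  using assms mk_map_app[of f] by (auto simp: hom_set_def SET_def)

text \<open>An arrow consists of its source, its target and a function that is
  \<open>undefined\<close> off the source, so agreement on the source is equality.\<close>

lemma hom_SET_eqI:
  assumes "f \<in> hom_set SET X Y" "g \<in> hom_set SET X Y" "\<And>x. x \<in> elts X \<Longrightarrow> app f x = app g x"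
  shows "f = g"
  using assms hom_SET_mk_map mk_map_eq_iff by metis

lemma category_SET: "category SET"
proof
  show "g \<cdot>\<^bsub>SET\<^esub> f \<in> hom_set SET X Z"
    if "f \<in> hom_set SET X Y" "g \<in> hom_set SET Y Z" for f g :: "'a setmap" and X Y Z
    using that by (auto simp: hom_SETD intro!: mk_map_hom dest: hom_SETD(3))
  show "f \<cdot>\<^bsub>SET\<^esub> Ident SET X = f" "Ident SET Y \<cdot>\<^bsub>SET\<^esub> f = f"
    if "f \<in> hom_set SET X Y" for f :: "'a setmap" and X Y
    using hom_SET_mk_map[OF that] hom_SETD[OF that] by simp_all
  show "(h \<cdot>\<^bsub>SET\<^esub> g) \<cdot>\<^bsub>SET\<^esub> f = h \<cdot>\<^bsub>SET\<^esub> (g \<cdot>\<^bsub>SET\<^esub> f)"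
    if "f \<in> hom_set SET W X" "g \<in> hom_set SET X Y" "h \<in> hom_set SET Y Z"
    for f g h :: "'a setmap" and W X Y Z
    using that by (auto simp: mk_map_eq_iff hom_SETD)
qed (auto intro: mk_map_hom)

interpretation SET: category SET by (rule category_SET)

lemma app_Comp:
  assumes "f \<in> hom_set SET X Y" "x \<in> elts X"
  shows "app (g \<cdot>\<^bsub>SET\<^esub> f) x = app g (app f x)"
  using assms by (simp add: hom_SETD)

lemma Obj_FINSET [simp]: "Obj FINSET = {X. finite (elts X)}"
  and Ident_FINSET [simp]: "Ident FINSET = Ident SET"
  and Comp_FINSET [simp]: "Comp FINSET = Comp SET"
  by (simp_all add: FINSET_def SET_def)

lemma hom_FINSET_iff:
  "f \<in> hom_set FINSET X Y \<longleftrightarrow> f \<in> hom_set SET X Y \<and> finite (elts X) \<and> finite (elts Y)"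
  by (auto simp: hom_set_def FINSET_def SET_def)

lemma category_FINSET: "category FINSET"
proof
  show "g \<cdot>\<^bsub>FINSET\<^esub> f \<in> hom_set FINSET X Z"
    if "f \<in> hom_set FINSET X Y" "g \<in> hom_set FINSET Y Z" for f g :: "'a setmap" and X Y Z
    using that SET.comp_hom by (metis Comp_FINSET hom_FINSET_iff)
  show "f \<cdot>\<^bsub>FINSET\<^esub> Ident FINSET X = f" "Ident FINSET Y \<cdot>\<^bsub>FINSET\<^esub> f = f"
    if "f \<in> hom_set FINSET X Y" for f :: "'a setmap" and X Y
    using that SET.comp_ident[of f X Y] SET.ident_comp[of f X Y]
    by (simp_all only: Comp_FINSET Ident_FINSET hom_FINSET_iff)
  show "(h \<cdot>\<^bsub>FINSET\<^esub> g) \<cdot>\<^bsub>FINSET\<^esub> f = h \<cdot>\<^bsub>FINSET\<^esub> (g \<cdot>\<^bsub>FINSET\<^esub> f)"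
    if "f \<in> hom_set FINSET W X" "g \<in> hom_set FINSET X Y" "h \<in> hom_set FINSET Y Z"
    for f g h :: "'a setmap" and W X Y Z
    using that SET.comp_assoc[of f W X g Y h Z] by (simp only: Comp_FINSET hom_FINSET_iff)
qed (auto simp: hom_FINSET_iff intro: mk_map_hom, auto simp: FINSET_def SET_def)

interpretation FINSET: category FINSET by (rule category_FINSET)

lemma fin_inclusion_simps [simp]: "onObj fin_inclusion X = X" "onArr fin_inclusion f = f"
  by (simp_all add: fin_inclusion_def)

interpretation fin_inclusion: is_functor FINSET SET fin_inclusion
  by unfold_locales (auto simp: hom_FINSET_iff)

section \<open>The powerset monad on finite sets\<close>

lemma powerset_monad_simps [simp]:
  "onObj (Fun powerset_monad) X = pow_obj X"
  "onArr (Fun powerset_monad) f =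
     mk_map (pow_obj (src f)) (pow_obj (tgt f)) (\<lambda>A. code (app f ` elts A))"
  "unit powerset_monad X = mk_map X (pow_obj X) (\<lambda>x. code {x})"
  "mult powerset_monad X =
     mk_map (pow_obj (pow_obj X)) (pow_obj X) (\<lambda>\<A>. code (\<Union>A \<in> elts \<A>. elts A))"
  by (simp_all add: powerset_monad_def)

interpretation powerset_functor: is_functor FINSET FINSET "Fun powerset_monad"
proof unfold_locales
  show "onArr (Fun powerset_monad) f \<in>
      hom_set FINSET (onObj (Fun powerset_monad) X) (onObj (Fun powerset_monad) Y)"
    if "f \<in> hom_set FINSET X Y" for f :: "'a setmap" and X Y
  proof -
    have f: "f \<in> hom_set SET X Y" "finite (elts X)" "finite (elts Y)"
      using that by (auto simp: hom_FINSET_iff)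
    show ?thesis
      using f(2,3) hom_SETD[OF f(1)] by (fastforce simp: hom_FINSET_iff intro!: mk_map_hom)
  qed
  show "onArr (Fun powerset_monad) (g \<cdot>\<^bsub>FINSET\<^esub> f) =
      onArr (Fun powerset_monad) g \<cdot>\<^bsub>FINSET\<^esub> onArr (Fun powerset_monad) f"
    if "f \<in> hom_set FINSET X Y" "g \<in> hom_set FINSET Y Z" for f g :: "'a setmap" and X Y Z
  proof -
    have f: "f \<in> hom_set SET X Y" and g: "g \<in> hom_set SET Y Z"
      using that by (auto simp: hom_FINSET_iff)
    note [simp] = hom_SETD[OF f] hom_SETD[OF g]
    have "app f ` elts A \<subseteq> elts Y" if "elts A \<subseteq> elts X" for A
      using that by auto
    then show ?thesis
      by (auto simp: image_image intro!: mk_map_elts_eqI)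
  qed
qed (auto intro!: mk_map_elts_eqI)

interpretation powerset_unit: nat_trans FINSET FINSET id_func "Fun powerset_monad" "unit powerset_monad"
proof unfold_locales
  show "onArr (Fun powerset_monad) f \<cdot>\<^bsub>FINSET\<^esub> unit powerset_monad X =
      unit powerset_monad Y \<cdot>\<^bsub>FINSET\<^esub> onArr id_func f"
    if "f \<in> hom_set FINSET X Y" for f :: "'a setmap" and X Y
  proof -
    have f: "f \<in> hom_set SET X Y"
      using that by (auto simp: hom_FINSET_iff)
    note [simp] = hom_SETD[OF f]
    show ?thesis by (auto intro!: mk_map_elts_eqI)
  qed
qed (auto simp: hom_FINSET_iff intro!: mk_map_hom)

interpretation powerset_mult: nat_trans FINSET FINSET
  "Fun powerset_monad \<circ>\<^sub>F Fun powerset_monad" "Fun powerset_monad" "mult powerset_monad"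
proof (intro nat_trans.intro nat_trans_axioms.intro is_functor_comp; (unfold_locales)?)
  show "onArr (Fun powerset_monad) f \<cdot>\<^bsub>FINSET\<^esub> mult powerset_monad X =
      mult powerset_monad Y \<cdot>\<^bsub>FINSET\<^esub> onArr (Fun powerset_monad \<circ>\<^sub>F Fun powerset_monad) f"
    if "f \<in> hom_set FINSET X Y" for f :: "'a setmap" and X Y
  proof -
    have f: "f \<in> hom_set SET X Y"
      using that by (auto simp: hom_FINSET_iff)
    note [simp] = hom_SETD[OF f]
    have f_elts: "app f x \<in> elts Y" if "x \<in> elts A" "A \<in> elts \<A>" "\<A> \<in> elts (pow_obj (pow_obj X))" for x A \<A>
      using that by (intro hom_SETD(3)[OF f]) auto
    \<comment> \<open>Both composites are brought to this common form, the union of the direct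
      images of the members.\<close>
    have "onArr (Fun powerset_monad) f \<cdot>\<^bsub>FINSET\<^esub> mult powerset_monad X =
      mk_map (pow_obj (pow_obj X)) (pow_obj Y) (\<lambda>\<A>. code (\<Union>A \<in> elts \<A>. app f ` elts A))"
      by (auto simp: image_UN UN_subset_iff simp flip: Ball_Collect intro!: mk_map_cong)
    moreover have "elts \<A> \<subseteq> elts (pow_obj X)"
        "code ((\<lambda>A. code (app f ` elts A)) ` elts \<A>) \<in> elts (pow_obj (pow_obj Y))"
      if "\<A> \<in> elts (pow_obj (pow_obj X))" for \<A>
      using that f_elts[OF _ _ that] by auto
    ultimately show ?thesis
      by (auto simp del: elts_pow_obj intro!: mk_map_cong)
  qed
qed (fastforce simp: hom_FINSET_iff intro!: mk_map_hom)

interpretation powerset: monad FINSET powerset_monad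
proof unfold_locales
  fix X :: 'a
  show "mult powerset_monad X \<cdot>\<^bsub>FINSET\<^esub> onArr (Fun powerset_monad) (mult powerset_monad X) =
      mult powerset_monad X \<cdot>\<^bsub>FINSET\<^esub> mult powerset_monad (onObj (Fun powerset_monad) X)"
    by (auto simp: UN_subset_iff image_subset_iff simp flip: Ball_Collect intro!: mk_map_elts_eqI)
  show "mult powerset_monad X \<cdot>\<^bsub>FINSET\<^esub> unit powerset_monad (onObj (Fun powerset_monad) X) =
      Ident FINSET (onObj (Fun powerset_monad) X)"
    by (auto intro!: mk_map_elts_eqI)
  show "mult powerset_monad X \<cdot>\<^bsub>FINSET\<^esub> onArr (Fun powerset_monad) (unit powerset_monad X) =
      Ident FINSET (onObj (Fun powerset_monad) X)"
    by (auto simp: subset_eq intro!: mk_map_elts_eqI)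
qed

section \<open>The filter monad\<close>

text \<open>Filters on \<open>X\<close> lie in its double power set, so by separation they form a
  set of the universe.\<close>

lemma elts_filter_obj: "elts (filter_obj X) = {\<F>. filter_on (elts X) (elts ` elts \<F>)}"
proof -
  have "{\<F>. filter_on (elts X) (elts ` elts \<F>)} \<subseteq> elts (pow_obj (pow_obj X))"
    by (auto simp: filter_on_def)
  then show ?thesis
    unfolding filter_obj_def by (rule elts_code_subset)
qed

lemma elts_image_iff: "A \<subseteq> elts X \<Longrightarrow> A \<in> elts ` S \<longleftrightarrow> code A \<in> S"
  by (metis code_elts elts_code_subset imageE imageI)

text \<open>\<open>filter_on\<close> quantifies over HOL sets, this form over codes. They agree
  since separation gives every subset of \<open>elts X\<close> a code.\<close>

lemma mem_filter_obj_iff: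
  "\<F> \<in> elts (filter_obj X) \<longleftrightarrow> (\<forall>A \<in> elts \<F>. elts A \<subseteq> elts X) \<and> X \<in> elts \<F> \<and>
     (\<forall>A B. elts A \<subseteq> elts X \<longrightarrow> elts B \<subseteq> elts X \<longrightarrow>
       (code (elts A \<inter> elts B) \<in> elts \<F> \<longleftrightarrow> A \<in> elts \<F> \<and> B \<in> elts \<F>))" (is "_ \<longleftrightarrow> ?R")
proof
  assume F: "\<F> \<in> elts (filter_obj X)"
  then have Int: "A \<inter> B \<in> elts ` elts \<F> \<longleftrightarrow> A \<in> elts ` elts \<F> \<and> B \<in> elts ` elts \<F>"
    if "A \<subseteq> elts X" "B \<subseteq> elts X" for A B
    using that by (simp add: elts_filter_obj filter_on_def)
  have "code (elts A \<inter> elts B) \<in> elts \<F> \<longleftrightarrow> A \<in> elts \<F> \<and> B \<in> elts \<F>"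
    if "elts A \<subseteq> elts X" "elts B \<subseteq> elts X" for A B
    using Int[OF that] that elts_image_iff[OF le_infI1[OF that(1)], of "elts B" "elts \<F>"]
      elts_image_iff[of "elts A" X] elts_image_iff[of "elts B" X] by simp
  with F show ?R
    using elts_image_iff[of "elts X" X "elts \<F>"] by (auto simp: elts_filter_obj filter_on_def)
next
  assume R: ?R
  have "A \<inter> B \<in> elts ` elts \<F> \<longleftrightarrow> A \<in> elts ` elts \<F> \<and> B \<in> elts ` elts \<F>"
    if "A \<subseteq> elts X" "B \<subseteq> elts X" for A B
  proof -
    have "A \<inter> B \<subseteq> elts X" using that by auto
    moreover have "elts (code A) = A" "elts (code B) = B"
      using elts_code_subset[OF that(1)] elts_code_subset[OF that(2)] .
    ultimately show ?thesis
      using R that by (metis elts_image_iff)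
  qed
  with R show "\<F> \<in> elts (filter_obj X)"
    by (auto simp: elts_filter_obj filter_on_def)
qed

text \<open>All filters constructed below (images, units, multiplications, values of the comparison
  map) are cut out by such a predicate.\<close>

lemma filter_objI:
  assumes "P X"
    and "\<And>A B. elts A \<subseteq> elts X \<Longrightarrow> elts B \<subseteq> elts X \<Longrightarrow> P (code (elts A \<inter> elts B)) \<longleftrightarrow> P A \<and> P B"
  shows "code {A. elts A \<subseteq> elts X \<and> P A} \<in> elts (filter_obj X)"
  using assms by (auto simp: mem_filter_obj_iff)

lemma filter_objD:
  assumes "\<F> \<in> elts (filter_obj X)"
  shows "A \<in> elts \<F> \<Longrightarrow> elts A \<subseteq> elts X" "X \<in> elts \<F>"
    "elts A \<subseteq> elts X \<Longrightarrow> elts B \<subseteq> elts X \<Longrightarrow>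
      code (elts A \<inter> elts B) \<in> elts \<F> \<longleftrightarrow> A \<in> elts \<F> \<and> B \<in> elts \<F>"
  using assms unfolding mem_filter_obj_iff by blast+

text \<open>If A is contained in B then their intersection is A, so upward closure is part of the
  intersection axiom.\<close>

lemma filter_obj_upward:
  assumes "\<F> \<in> elts (filter_obj X)" "A \<in> elts \<F>" "elts A \<subseteq> elts B" "elts B \<subseteq> elts X"
  shows "B \<in> elts \<F>"
  using filter_objD(3)[OF assms(1), of A B] assms by (auto simp: Int_absorb2)

lemma filter_obj_eqI:
  assumes "\<F> \<in> elts (filter_obj X)" "\<G> \<in> elts (filter_obj X)"
    and "\<And>A. elts A \<subseteq> elts X \<Longrightarrow> A \<in> elts \<F> \<longleftrightarrow> A \<in> elts \<G>"
  shows "\<F> = \<G>"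
  using assms filter_objD(1) by (blast intro: extensionality)

abbreviation preimage :: "'v::universe setmap \<Rightarrow> 'v \<Rightarrow> 'v" where
  "preimage f B \<equiv> code {x \<in> elts (src f). app f x \<in> elts B}"

lemma preimage_Int:
  "preimage f (code (elts A \<inter> elts B)) = code (elts (preimage f A) \<inter> elts (preimage f B))"
  by (auto intro!: arg_cong[where f = code])

lemma preimage_Comp:
  assumes "f \<in> hom_set SET X Y" "g \<in> hom_set SET Y Z"
  shows "preimage (g \<cdot>\<^bsub>SET\<^esub> f) B = preimage f (preimage g B)"
  using assms by (auto simp: hom_SETD intro!: arg_cong[where f = code])

section \<open>The functor of filters\<close>

lemma filter_monad_simps [simp]:
  "onObj (Fun filter_monad) X = filter_obj X"
  "onArr (Fun filter_monad) f = filter_map f"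
  "unit filter_monad X = filter_unit X"
  "mult filter_monad X = filter_mult X"
  by (simp_all add: filter_monad_def)

lemma src_filter_map [simp]: "src (filter_map f) = filter_obj (src f)"
  and tgt_filter_map [simp]: "tgt (filter_map f) = filter_obj (tgt f)"
  by (simp_all add: filter_map_def)

lemma mem_filter_map:
  assumes "f \<in> hom_set SET X Y" "\<F> \<in> elts (filter_obj X)"
  shows "B \<in> elts (app (filter_map f) \<F>) \<longleftrightarrow> elts B \<subseteq> elts Y \<and> preimage f B \<in> elts \<F>"
  using assms by (simp add: filter_map_def hom_SETD)

text \<open>Inverse image preserves the whole set and binary intersections, hence transports the
  filter axioms.\<close>

lemma filter_map_hom:
  assumes f: "f \<in> hom_set SET X Y"
  shows "filter_map f \<in> hom_set SET (filter_obj X) (filter_obj Y)"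
  unfolding filter_map_def hom_SETD[OF f]
proof (rule mk_map_hom, rule filter_objI)
  fix \<F> assume F: "\<F> \<in> elts (filter_obj X)"
  have "preimage f Y = X"
    using hom_SETD[OF f] by (auto intro: extensionality)
  then show "code {x \<in> elts X. app f x \<in> elts Y} \<in> elts \<F>"
    using filter_objD(2)[OF F] hom_SETD[OF f] by simp
  show "code {x \<in> elts X. app f x \<in> elts (code (elts A \<inter> elts B))} \<in> elts \<F> \<longleftrightarrow>
      code {x \<in> elts X. app f x \<in> elts A} \<in> elts \<F> \<and> code {x \<in> elts X. app f x \<in> elts B} \<in> elts \<F>" for A B
    using filter_objD(3)[OF F, of "preimage f A" "preimage f B"] preimage_Int[of f A B]
      hom_SETD[OF f] by simp
qed

interpretation filter_functor: is_functor SET SET "Fun filter_monad"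
proof unfold_locales
  show "onArr (Fun filter_monad) f \<in>
      hom_set SET (onObj (Fun filter_monad) X) (onObj (Fun filter_monad) Y)"
    if "f \<in> hom_set SET X Y" for f :: "'a setmap" and X Y
    using filter_map_hom[OF that] by simp
next
  fix X :: 'a
  have I: "mk_map X X (\<lambda>x. x) \<in> hom_set SET X X"
    by (rule mk_map_hom)
  show "onArr (Fun filter_monad) (Ident SET X) = Ident SET (onObj (Fun filter_monad) X)"
    unfolding filter_monad_simps Ident_SET
  proof (rule hom_SET_eqI[OF filter_map_hom[OF I] mk_map_hom])
    fix \<F> assume F: "\<F> \<in> elts (filter_obj X)"
    have "preimage (mk_map X X (\<lambda>x. x)) B = B" if "elts B \<subseteq> elts X" for B
      using that by (auto simp: subset_iff intro!: extensionality)
    then show "app (filter_map (mk_map X X (\<lambda>x. x))) \<F> =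
        app (mk_map (filter_obj X) (filter_obj X) (\<lambda>x. x)) \<F>"
      using F filter_objD(1)[OF F] by (auto simp: mem_filter_map[OF I F] intro!: extensionality)
  qed
next
  fix f g :: "'a setmap" and X Y Z
  assume f: "f \<in> hom_set SET X Y" and g: "g \<in> hom_set SET Y Z"
  note gf = SET.comp_hom[OF f g] and Ff = filter_map_hom[OF f] and Fg = filter_map_hom[OF g]
  show "onArr (Fun filter_monad) (g \<cdot>\<^bsub>SET\<^esub> f) =
      onArr (Fun filter_monad) g \<cdot>\<^bsub>SET\<^esub> onArr (Fun filter_monad) f"
    unfolding filter_monad_simps
  proof (rule hom_SET_eqI[OF filter_map_hom[OF gf] SET.comp_hom[OF Ff Fg]])
    fix \<F> assume F: "\<F> \<in> elts (filter_obj X)"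
    show "app (filter_map (g \<cdot>\<^bsub>SET\<^esub> f)) \<F> = app (filter_map g \<cdot>\<^bsub>SET\<^esub> filter_map f) \<F>"
      unfolding app_Comp[OF Ff F]
    proof (rule extensionality, rule set_eqI)
      fix B
      have "elts (preimage g B) \<subseteq> elts Y"
        using hom_SETD[OF g] by auto
      then show "B \<in> elts (app (filter_map (g \<cdot>\<^bsub>SET\<^esub> f)) \<F>) \<longleftrightarrow>
          B \<in> elts (app (filter_map g) (app (filter_map f) \<F>))"
        unfolding mem_filter_map[OF gf F] mem_filter_map[OF g hom_SETD(3)[OF Ff F]]
          mem_filter_map[OF f F] preimage_Comp[OF f g] by blast
    qed
  qed
qed simp

section \<open>Unit and multiplication of the filter monad\<close>

lemma mem_filter_unit:
  assumes "x \<in> elts X"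
  shows "A \<in> elts (app (filter_unit X) x) \<longleftrightarrow> elts A \<subseteq> elts X \<and> x \<in> elts A"
  using assms by (simp add: filter_unit_def)

lemma filter_unit_hom: "filter_unit X \<in> hom_set SET X (filter_obj X)"
  unfolding filter_unit_def by (intro mk_map_hom filter_objI) auto

lemma elts_sharp: "elts (sharp X A) = {\<F> \<in> elts (filter_obj X). A \<in> elts \<F>}"
  by (simp add: sharp_def)

text \<open>The intersection axiom, read for all filters at once. Together with
  \<open>sharp_top\<close> it shows that the multiplication yields filters.\<close>

lemma sharp_Int:
  assumes "elts A \<subseteq> elts X" "elts B \<subseteq> elts X"
  shows "sharp X (code (elts A \<inter> elts B)) = code (elts (sharp X A) \<inter> elts (sharp X B))"
  using filter_objD(3)[OF _ assms]
  by (intro extensionality, unfold elts_code_Int) (auto simp: elts_sharp)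

lemma sharp_top: "sharp X X = filter_obj X"
  using filter_objD(2) by (auto simp: elts_sharp intro!: extensionality)

lemma mem_filter_mult:
  assumes "\<Phi> \<in> elts (filter_obj (filter_obj X))"
  shows "A \<in> elts (app (filter_mult X) \<Phi>) \<longleftrightarrow> elts A \<subseteq> elts X \<and> sharp X A \<in> elts \<Phi>"
  using assms by (simp add: filter_mult_def)

lemma filter_mult_hom: "filter_mult X \<in> hom_set SET (filter_obj (filter_obj X)) (filter_obj X)"
  unfolding filter_mult_def
proof (intro mk_map_hom filter_objI)
  fix \<Phi> assume \<Phi>: "\<Phi> \<in> elts (filter_obj (filter_obj X))"
  show "sharp X X \<in> elts \<Phi>"
    using filter_objD(2)[OF \<Phi>] by (simp add: sharp_top)
  show "sharp X (code (elts A \<inter> elts B)) \<in> elts \<Phi> \<longleftrightarrow> sharp X A \<in> elts \<Phi> \<and> sharp X B \<in> elts \<Phi>"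
    if "elts A \<subseteq> elts X" "elts B \<subseteq> elts X" for A B
    using filter_objD(3)[OF \<Phi>, of "sharp X A" "sharp X B"] sharp_Int[OF that]
    by (auto simp: elts_sharp)
qed

interpretation filter_unit: nat_trans SET SET id_func "Fun filter_monad" "unit filter_monad"
proof (intro nat_trans.intro nat_trans_axioms.intro is_functor_id; (unfold_locales)?)
  show "unit filter_monad X \<in> hom_set SET (onObj id_func X) (onObj (Fun filter_monad) X)" for X :: 'a
    using filter_unit_hom by simp
next
  fix f :: "'a setmap" and X Y assume f: "f \<in> hom_set SET X Y"
  note U = filter_unit_hom and Ff = filter_map_hom[OF f]
  have "filter_map f \<cdot>\<^bsub>SET\<^esub> filter_unit X = filter_unit Y \<cdot>\<^bsub>SET\<^esub> f"
  proof (rule hom_SET_eqI[OF SET.comp_hom[OF U Ff] SET.comp_hom[OF f U]])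
    fix x assume x: "x \<in> elts X"
    have "B \<in> elts (app (filter_map f) (app (filter_unit X) x)) \<longleftrightarrow>
        B \<in> elts (app (filter_unit Y) (app f x))" for B
      using x hom_SETD[OF f] by (auto simp: mem_filter_map[OF f] hom_SETD(3)[OF U] mem_filter_unit)
    then show "app (filter_map f \<cdot>\<^bsub>SET\<^esub> filter_unit X) x = app (filter_unit Y \<cdot>\<^bsub>SET\<^esub> f) x"
      unfolding app_Comp[OF U x] app_Comp[OF f x] by (blast intro: extensionality)
  qed
  then show "onArr (Fun filter_monad) f \<cdot>\<^bsub>SET\<^esub> unit filter_monad X =
      unit filter_monad Y \<cdot>\<^bsub>SET\<^esub> onArr id_func f"
    by (simp only: filter_monad_simps id_func_simps)
qed

text \<open>Membership in a multiplied or mapped filter is membership of an inverse image, so this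
  identity of sets is the naturality of the multiplication.\<close>

lemma preimage_sharp:
  assumes "f \<in> hom_set SET X Y" "elts A \<subseteq> elts Y"
  shows "preimage (filter_map f) (sharp Y A) = sharp X (preimage f A)"
  using hom_SETD(1,2)[OF assms(1)] hom_SETD(3)[OF filter_map_hom[OF assms(1)]] assms(2)
  by (auto simp: elts_sharp mem_filter_map[OF assms(1)] intro!: extensionality)

text \<open>The associativity law, expressed through inverse images.\<close>

lemma preimage_filter_mult:
  assumes "elts A \<subseteq> elts X"
  shows "preimage (filter_mult X) (sharp X A) = sharp (filter_obj X) (sharp X A)"
  using hom_SETD[OF filter_mult_hom[of X]] assms
  by (auto simp: elts_sharp mem_filter_mult intro!: extensionality)

text \<open>The unit law for \<open>filter_map (filter_unit X)\<close>, expressed through inverse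
  images.\<close>

lemma preimage_filter_unit:
  assumes "elts A \<subseteq> elts X"
  shows "preimage (filter_unit X) (sharp X A) = A"
  using hom_SETD[OF filter_unit_hom[of X]] assms
  by (auto simp: elts_sharp mem_filter_unit subset_iff intro!: extensionality)

lemma elts_sharp_subset: "elts (sharp X A) \<subseteq> elts (filter_obj X)"
  by (auto simp: elts_sharp)

interpretation filter_mult: nat_trans SET SET "Fun filter_monad \<circ>\<^sub>F Fun filter_monad"
  "Fun filter_monad" "mult filter_monad"
proof (intro nat_trans.intro nat_trans_axioms.intro is_functor_comp; (unfold_locales)?)
  show "mult filter_monad X \<in>
      hom_set SET (onObj (Fun filter_monad \<circ>\<^sub>F Fun filter_monad) X) (onObj (Fun filter_monad) X)"
    for X :: 'a
    using filter_mult_hom by simp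
next
  fix f :: "'a setmap" and X Y assume f: "f \<in> hom_set SET X Y"
  note M = filter_mult_hom and Ff = filter_map_hom[OF f] and FFf = filter_map_hom[OF filter_map_hom[OF f]]
  have "filter_map f \<cdot>\<^bsub>SET\<^esub> filter_mult X = filter_mult Y \<cdot>\<^bsub>SET\<^esub> filter_map (filter_map f)"
  proof (rule hom_SET_eqI[OF SET.comp_hom[OF M Ff] SET.comp_hom[OF FFf M]])
    fix \<Phi> assume \<Phi>: "\<Phi> \<in> elts (filter_obj (filter_obj X))"
    have "B \<in> elts (app (filter_map f) (app (filter_mult X) \<Phi>)) \<longleftrightarrow>
        B \<in> elts (app (filter_mult Y) (app (filter_map (filter_map f)) \<Phi>))" for B
      using elts_sharp_subset hom_SETD(1)[OF f] preimage_sharp[OF f, of B]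
      unfolding mem_filter_map[OF f hom_SETD(3)[OF M \<Phi>]]
        mem_filter_mult[OF \<Phi>] mem_filter_mult[OF hom_SETD(3)[OF FFf \<Phi>]] mem_filter_map[OF Ff \<Phi>]
      by auto
    then show "app (filter_map f \<cdot>\<^bsub>SET\<^esub> filter_mult X) \<Phi> =
        app (filter_mult Y \<cdot>\<^bsub>SET\<^esub> filter_map (filter_map f)) \<Phi>"
      unfolding app_Comp[OF M \<Phi>] app_Comp[OF FFf \<Phi>] by (blast intro: extensionality)
  qed
  then show "onArr (Fun filter_monad) f \<cdot>\<^bsub>SET\<^esub> mult filter_monad X =
      mult filter_monad Y \<cdot>\<^bsub>SET\<^esub> onArr (Fun filter_monad \<circ>\<^sub>F Fun filter_monad) f"
    by (simp only: filter_monad_simps comp_func_simps)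
qed

interpretation filter: monad SET filter_monad
proof unfold_locales
  fix X :: 'a
  note M = filter_mult_hom and U = filter_unit_hom
    and FM = filter_map_hom[OF filter_mult_hom] and FU = filter_map_hom[OF filter_unit_hom]
  have I: "mk_map (filter_obj X) (filter_obj X) (\<lambda>x. x) \<in> hom_set SET (filter_obj X) (filter_obj X)"
    by (rule mk_map_hom)
  have "filter_mult X \<cdot>\<^bsub>SET\<^esub> filter_map (filter_mult X) = filter_mult X \<cdot>\<^bsub>SET\<^esub> filter_mult (filter_obj X)"
  proof (rule hom_SET_eqI[OF SET.comp_hom[OF FM M] SET.comp_hom[OF M M]])
    fix \<Psi> assume \<Psi>: "\<Psi> \<in> elts (filter_obj (filter_obj (filter_obj X)))"
    have "B \<in> elts (app (filter_mult X) (app (filter_map (filter_mult X)) \<Psi>)) \<longleftrightarrow>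
        B \<in> elts (app (filter_mult X) (app (filter_mult (filter_obj X)) \<Psi>))" for B
      using elts_sharp_subset unfolding mem_filter_mult[OF \<Psi>] mem_filter_map[OF M \<Psi>]
        mem_filter_mult[OF hom_SETD(3)[OF M \<Psi>]] mem_filter_mult[OF hom_SETD(3)[OF FM \<Psi>]]
      by (auto simp: preimage_filter_mult simp del: elts_code_Collect)
    then show "app (filter_mult X \<cdot>\<^bsub>SET\<^esub> filter_map (filter_mult X)) \<Psi> =
        app (filter_mult X \<cdot>\<^bsub>SET\<^esub> filter_mult (filter_obj X)) \<Psi>"
      unfolding app_Comp[OF M \<Psi>] app_Comp[OF FM \<Psi>] by (blast intro: extensionality)
  qed
  then show "mult filter_monad X \<cdot>\<^bsub>SET\<^esub> onArr (Fun filter_monad) (mult filter_monad X) =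
      mult filter_monad X \<cdot>\<^bsub>SET\<^esub> mult filter_monad (onObj (Fun filter_monad) X)"
    by (simp only: filter_monad_simps)
  have "filter_mult X \<cdot>\<^bsub>SET\<^esub> filter_unit (filter_obj X) = mk_map (filter_obj X) (filter_obj X) (\<lambda>x. x)"
  proof (rule hom_SET_eqI[OF SET.comp_hom[OF U M] I])
    fix \<F> assume F: "\<F> \<in> elts (filter_obj X)"
    have "B \<in> elts (app (filter_mult X) (app (filter_unit (filter_obj X)) \<F>)) \<longleftrightarrow> B \<in> elts \<F>" for B
      using filter_objD(1)[OF F] F
      unfolding mem_filter_mult[OF hom_SETD(3)[OF U F]] mem_filter_unit[OF F]
      by (auto simp: elts_sharp)
    then show "app (filter_mult X \<cdot>\<^bsub>SET\<^esub> filter_unit (filter_obj X)) \<F> =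
        app (mk_map (filter_obj X) (filter_obj X) (\<lambda>x. x)) \<F>"
      unfolding app_Comp[OF U F] app_mk_map[OF F] by (blast intro: extensionality)
  qed
  then show "mult filter_monad X \<cdot>\<^bsub>SET\<^esub> unit filter_monad (onObj (Fun filter_monad) X) =
      Ident SET (onObj (Fun filter_monad) X)"
    by (simp only: filter_monad_simps Ident_SET)
  have "filter_mult X \<cdot>\<^bsub>SET\<^esub> filter_map (filter_unit X) = mk_map (filter_obj X) (filter_obj X) (\<lambda>x. x)"
  proof (rule hom_SET_eqI[OF SET.comp_hom[OF FU M] I])
    fix \<F> assume F: "\<F> \<in> elts (filter_obj X)"
    have "B \<in> elts (app (filter_mult X) (app (filter_map (filter_unit X)) \<F>)) \<longleftrightarrow> B \<in> elts \<F>" for B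
      using filter_objD(1)[OF F] elts_sharp_subset
      unfolding mem_filter_mult[OF hom_SETD(3)[OF FU F]] mem_filter_map[OF U F]
      by (auto simp: preimage_filter_unit dest: subsetD[OF elts_sharp_subset])
    then show "app (filter_mult X \<cdot>\<^bsub>SET\<^esub> filter_map (filter_unit X)) \<F> =
        app (mk_map (filter_obj X) (filter_obj X) (\<lambda>x. x)) \<F>"
      unfolding app_Comp[OF FU F] app_mk_map[OF F] by (blast intro: extensionality)
  qed
  then show "mult filter_monad X \<cdot>\<^bsub>SET\<^esub> onArr (Fun filter_monad) (unit filter_monad X) =
      Ident SET (onObj (Fun filter_monad) X)"
    by (simp only: filter_monad_simps Ident_SET)
qed

section \<open>The filter monad as a Kan extension\<close>

text \<open>The counit. Bounding the intersection by \<open>elts X\<close> lets separation supply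
  its code.\<close>

definition filter_core :: "'v::universe \<Rightarrow> 'v setmap" where
  "filter_core X = mk_map (filter_obj X) (pow_obj X) (\<lambda>\<F>. code {x \<in> elts X. \<forall>A \<in> elts \<F>. x \<in> elts A})"

lemma filter_core_hom: "filter_core X \<in> hom_set SET (filter_obj X) (pow_obj X)"
  unfolding filter_core_def by (rule mk_map_hom) auto

text \<open>Binary intersections give finite ones; the empty intersection is \<open>X\<close>,
  itself a member.\<close>

lemma filter_obj_INT:
  assumes F: "\<F> \<in> elts (filter_obj X)" and S: "finite S" "S \<subseteq> elts \<F>"
  shows "code {x \<in> elts X. \<forall>A \<in> S. x \<in> elts A} \<in> elts \<F>"
  using S
proof (induction S rule: finite_induct)
  case empty
  then show ?case using filter_objD(2)[OF F] by simp
next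
  case (insert A S)
  let ?I = "code {x \<in> elts X. \<forall>A \<in> S. x \<in> elts A}"
  have "code (elts ?I \<inter> elts A) \<in> elts \<F>"
    using insert filter_objD(1)[OF F, of A] filter_objD(3)[OF F, of ?I A] by auto
  moreover have "elts ?I \<inter> elts A = {x \<in> elts X. \<forall>A \<in> insert A S. x \<in> elts A}"
    by auto
  ultimately show ?case by simp
qed

text \<open>A filter on a finite set has finitely many members, so their intersection is again a
  member and the filter is principal.\<close>

lemma mem_iff_filter_core:
  assumes fin: "finite (elts X)" and F: "\<F> \<in> elts (filter_obj X)" and B: "elts B \<subseteq> elts X"
  shows "B \<in> elts \<F> \<longleftrightarrow> elts (app (filter_core X) \<F>) \<subseteq> elts B"
proof -
  let ?I = "code {x \<in> elts X. \<forall>A \<in> elts \<F>. x \<in> elts A}"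
  have "elts \<F> \<subseteq> {A. elts A \<subseteq> elts X}"
    using filter_objD(1)[OF F] by auto
  then have "finite (elts \<F>)"
    by (rule finite_subset) (simp add: fin)
  then have "?I \<in> elts \<F>"
    using filter_obj_INT[OF F] by blast
  then show ?thesis
    using filter_obj_upward[OF F, of ?I B] B F by (auto simp: filter_core_def)
qed

text \<open>A set is determined by the sets containing it: testing with \<open>S\<close> and with
  the core itself gives the two inclusions. Cores are computed this way below.\<close>

lemma filter_core_eqI:
  assumes "finite (elts X)" "\<F> \<in> elts (filter_obj X)" "elts S \<subseteq> elts X"
    and "\<And>B. elts B \<subseteq> elts X \<Longrightarrow> B \<in> elts \<F> \<longleftrightarrow> elts S \<subseteq> elts B"
  shows "app (filter_core X) \<F> = S"
proof (rule extensionality)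
  have C: "elts (app (filter_core X) \<F>) \<subseteq> elts X"
    using hom_SETD(3)[OF filter_core_hom assms(2)] by simp
  show "elts (app (filter_core X) \<F>) = elts S"
    using assms(4)[OF assms(3)] assms(4)[OF C] mem_iff_filter_core[OF assms(1,2) assms(3)]
      mem_iff_filter_core[OF assms(1,2) C] by auto
qed

text \<open>Direct image is left adjoint to inverse image: the image of the core lies in
  \<open>B\<close> iff the core lies in \<open>preimage f B\<close>.\<close>

lemma filter_core_map:
  assumes f: "f \<in> hom_set SET X Y" and fin: "finite (elts X)" "finite (elts Y)"
    and F: "\<F> \<in> elts (filter_obj X)"
  shows "app (filter_core Y) (app (filter_map f) \<F>) = code (app f ` elts (app (filter_core X) \<F>))"
proof (rule filter_core_eqI)
  have C: "elts (app (filter_core X) \<F>) \<subseteq> elts X"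
    using hom_SETD(3)[OF filter_core_hom F] by simp
  then show "elts (code (app f ` elts (app (filter_core X) \<F>))) \<subseteq> elts Y"
    using hom_SETD[OF f] by auto
  show "B \<in> elts (app (filter_map f) \<F>) \<longleftrightarrow> elts (code (app f ` elts (app (filter_core X) \<F>))) \<subseteq> elts B"
    if B: "elts B \<subseteq> elts Y" for B
  proof -
    have "elts (preimage f B) \<subseteq> elts X"
      using hom_SETD(1)[OF f] by auto
    then show ?thesis
      using B C hom_SETD(1)[OF f] mem_iff_filter_core[OF fin(1) F, of "preimage f B"]
      by (auto simp: mem_filter_map[OF f F])
  qed
qed (use fin hom_SETD(3)[OF filter_map_hom[OF f] F] in auto)

lemma filter_core_nat_trans:
  "nat_trans FINSET SET (Fun filter_monad \<circ>\<^sub>F fin_inclusion) (fin_inclusion \<circ>\<^sub>F Fun powerset_monad) filter_core"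
proof (intro nat_trans.intro nat_trans_axioms.intro is_functor_comp; (unfold_locales)?)
  show "filter_core X \<in> hom_set SET (onObj (Fun filter_monad \<circ>\<^sub>F fin_inclusion) X)
      (onObj (fin_inclusion \<circ>\<^sub>F Fun powerset_monad) X)" for X :: 'a
    using filter_core_hom by simp
next
  fix f :: "'a setmap" and X Y assume "f \<in> hom_set FINSET X Y"
  then have f: "f \<in> hom_set SET X Y" and fin: "finite (elts X)" "finite (elts Y)"
    by (auto simp: hom_FINSET_iff)
  have Pf: "onArr (Fun powerset_monad) f \<in> hom_set SET (pow_obj X) (pow_obj Y)"
    using powerset_functor.arr[of f X Y] f fin by (simp add: hom_FINSET_iff)
  have "onArr (Fun powerset_monad) f \<cdot>\<^bsub>SET\<^esub> filter_core X = filter_core Y \<cdot>\<^bsub>SET\<^esub> filter_map f"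
  proof (rule hom_SET_eqI[OF SET.comp_hom[OF filter_core_hom Pf]
        SET.comp_hom[OF filter_map_hom[OF f] filter_core_hom]])
    fix \<F> assume F: "\<F> \<in> elts (filter_obj X)"
    show "app (onArr (Fun powerset_monad) f \<cdot>\<^bsub>SET\<^esub> filter_core X) \<F> =
        app (filter_core Y \<cdot>\<^bsub>SET\<^esub> filter_map f) \<F>"
      unfolding app_Comp[OF filter_core_hom F] app_Comp[OF filter_map_hom[OF f] F]
        filter_core_map[OF f fin F]
      using hom_SETD(3)[OF filter_core_hom F] hom_SETD[OF f] by simp
  qed
  then show "onArr (fin_inclusion \<circ>\<^sub>F Fun powerset_monad) f \<cdot>\<^bsub>SET\<^esub> filter_core X =
      filter_core Y \<cdot>\<^bsub>SET\<^esub> onArr (Fun filter_monad \<circ>\<^sub>F fin_inclusion) f"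
    by (simp only: comp_func_simps fin_inclusion_simps filter_monad_simps)
qed

lemma filter_core_unit:
  assumes "finite (elts X)"
  shows "filter_core X \<cdot>\<^bsub>SET\<^esub> filter_unit X = unit powerset_monad X"
proof (rule hom_SET_eqI[OF SET.comp_hom[OF filter_unit_hom filter_core_hom]])
  show "unit powerset_monad X \<in> hom_set SET X (pow_obj X)"
    by (auto intro: mk_map_hom)
  fix x assume x: "x \<in> elts X"
  have "app (filter_core X) (app (filter_unit X) x) = code {x}"
    using x assms hom_SETD(3)[OF filter_unit_hom x]
    by (intro filter_core_eqI) (auto simp: mem_filter_unit)
  then show "app (filter_core X \<cdot>\<^bsub>SET\<^esub> filter_unit X) x = app (unit powerset_monad X) x"
    unfolding app_Comp[OF filter_unit_hom x] using x by simp
qed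

text \<open>Principality of filters on a finite set, as an identity of sets of filters; it links the
  two multiplications.\<close>

lemma preimage_filter_core:
  assumes "finite (elts X)" "elts A \<subseteq> elts X"
  shows "preimage (filter_core X) (pow_obj A) = sharp X A"
proof (rule extensionality, rule set_eqI)
  show "\<F> \<in> elts (preimage (filter_core X) (pow_obj A)) \<longleftrightarrow> \<F> \<in> elts (sharp X A)" for \<F>
    using mem_iff_filter_core[OF assms(1) _ assms(2), of \<F>] hom_SETD(1)[OF filter_core_hom[of X]]
    by (simp add: elts_sharp cong: conj_cong)
qed

text \<open>\<open>B\<close> belongs to the product filter iff \<open>sharp X B\<close>, which is
  the inverse image of \<open>pow_obj B\<close> under \<open>filter_core X\<close>, belongs to
  \<Phi>. On the finite set \<open>pow_obj X\<close> this says that the core of the mapped filter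
  lies in \<open>pow_obj B\<close>, that is, the union of that core lies in
  \<open>B\<close>.\<close>

lemma filter_core_mult:
  assumes fin: "finite (elts X)"
  shows "filter_core X \<cdot>\<^bsub>SET\<^esub> filter_mult X =
    mult powerset_monad X \<cdot>\<^bsub>SET\<^esub> filter_core (pow_obj X) \<cdot>\<^bsub>SET\<^esub> filter_map (filter_core X)"
proof -
  note C = filter_core_hom and M = filter_mult_hom and FC = filter_map_hom[OF filter_core_hom]
  have PM: "mult powerset_monad X \<in> hom_set SET (pow_obj (pow_obj X)) (pow_obj X)"
    using powerset_mult.component[of X] fin by (simp add: hom_FINSET_iff)
  note CFC = SET.comp_hom[OF FC C]
  have finP: "finite (elts (pow_obj X))"
    using fin by simp
  show ?thesis
  proof (rule hom_SET_eqI[OF SET.comp_hom[OF M C] SET.comp_hom[OF CFC PM]])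
    fix \<Phi> assume \<Phi>: "\<Phi> \<in> elts (filter_obj (filter_obj X))"
    note M\<Phi> = hom_SETD(3)[OF M \<Phi>] and FC\<Phi> = hom_SETD(3)[OF FC \<Phi>]
    let ?\<A> = "app (filter_core (pow_obj X)) (app (filter_map (filter_core X)) \<Phi>)"
    have \<A>: "?\<A> \<in> elts (pow_obj (pow_obj X))"
      by (rule hom_SETD(3)[OF C FC\<Phi>])
    have "app (filter_core X) (app (filter_mult X) \<Phi>) = code (\<Union>A \<in> elts ?\<A>. elts A)"
    proof (rule filter_core_eqI[OF fin M\<Phi>])
      show "elts (code (\<Union>A \<in> elts ?\<A>. elts A)) \<subseteq> elts X"
        using \<A> by auto
      show "B \<in> elts (app (filter_mult X) \<Phi>) \<longleftrightarrow> elts (code (\<Union>A \<in> elts ?\<A>. elts A)) \<subseteq> elts B"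
        if B: "elts B \<subseteq> elts X" for B
      proof -
        have PB: "elts (pow_obj B) \<subseteq> elts (pow_obj X)"
          using B by auto
        have "B \<in> elts (app (filter_mult X) \<Phi>) \<longleftrightarrow> pow_obj B \<in> elts (app (filter_map (filter_core X)) \<Phi>)"
          unfolding mem_filter_mult[OF \<Phi>] mem_filter_map[OF C \<Phi>] preimage_filter_core[OF fin B]
          using B PB by simp
        also have "\<dots> \<longleftrightarrow> elts ?\<A> \<subseteq> elts (pow_obj B)"
          by (rule mem_iff_filter_core[OF finP FC\<Phi> PB])
        finally show ?thesis by auto
      qed
    qed
    then show "app (filter_core X \<cdot>\<^bsub>SET\<^esub> filter_mult X) \<Phi> = app (mult powerset_monad X \<cdot>\<^bsub>SET\<^esub>
        filter_core (pow_obj X) \<cdot>\<^bsub>SET\<^esub> filter_map (filter_core X)) \<Phi>"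
      unfolding app_Comp[OF M \<Phi>] app_Comp[OF CFC \<Phi>] app_Comp[OF FC \<Phi>]
      using \<A> by simp
  qed
qed

section \<open>The comparison map of a competing functor\<close>

definition char_map :: "'v::universe \<Rightarrow> 'v \<Rightarrow> 'v setmap" where
  "char_map X A = mk_map X truth_values (\<lambda>x. if x \<in> elts A then truth else code {})"

lemma char_map_hom: "char_map X A \<in> hom_set SET X truth_values"
  unfolding char_map_def by (rule mk_map_hom) simp

text \<open>Under \<open>G\<close> this turns an inverse image along \<open>f\<close> into an
  application of \<open>onArr G f\<close>; naturality of the comparison map rests on it.\<close>

lemma char_map_preimage:
  assumes "f \<in> hom_set SET X Y"
  shows "char_map X (preimage f B) = char_map Y B \<cdot>\<^bsub>SET\<^esub> f"
  using hom_SETD[OF assms] by (auto simp: char_map_def intro!: mk_map_cong)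

text \<open>The formula is forced: by naturality at the characteristic map, \<open>A\<close> belongs
  to the value at \<open>t\<close> iff \<open>{truth}\<close> belongs to a filter on
  \<open>truth_values\<close>, and the factorisation requires that filter to have the core written
  here.\<close>

definition kan_map ::
    "('v::universe, 'v setmap, 'v, 'v setmap) func \<Rightarrow> ('v \<Rightarrow> 'v setmap) \<Rightarrow> 'v \<Rightarrow> 'v setmap" where
  "kan_map G \<alpha> X = mk_map (onObj G X) (filter_obj X) (\<lambda>t. code {A. elts A \<subseteq> elts X \<and>
     elts (app (\<alpha> truth_values) (app (onArr G (char_map X A)) t)) \<subseteq> {truth}})"

locale kan_competitor = nat_trans FINSET SET "G \<circ>\<^sub>F fin_inclusion" "fin_inclusion \<circ>\<^sub>F Fun powerset_monad" \<alpha> +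
  G: is_functor SET SET G
  for G :: "('v::universe, 'v setmap, 'v, 'v setmap) func" and \<alpha>
begin

lemma component_hom: "finite (elts X) \<Longrightarrow> \<alpha> X \<in> hom_set SET (onObj G X) (pow_obj X)"
  using component[of X] by simp

lemma component_subset:
  "finite (elts X) \<Longrightarrow> t \<in> elts (onObj G X) \<Longrightarrow> elts (app (\<alpha> X) t) \<subseteq> elts X"
  using hom_SETD(3)[OF component_hom] by fastforce

lemma component_map:
  assumes f: "f \<in> hom_set SET X Y" and fin: "finite (elts X)" "finite (elts Y)"
    and t: "t \<in> elts (onObj G X)"
  shows "elts (app (\<alpha> Y) (app (onArr G f) t)) = app f ` elts (app (\<alpha> X) t)"
proof -
  have "onArr (Fun powerset_monad) f \<cdot>\<^bsub>SET\<^esub> \<alpha> X = \<alpha> Y \<cdot>\<^bsub>SET\<^esub> onArr G f"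
    using naturality[of f X Y] f fin by (simp only: hom_FINSET_iff comp_func_simps fin_inclusion_simps simp_thms)
  then have "app (onArr (Fun powerset_monad) f) (app (\<alpha> X) t) = app (\<alpha> Y) (app (onArr G f) t)"
    using app_Comp[OF component_hom[OF fin(1)] t] app_Comp[OF G.arr[OF f] t] by metis
  then show ?thesis
    using component_subset[OF fin(1) t] hom_SETD[OF f] by (simp flip: elts_eq_iff)
qed

lemma G_Comp:
  assumes "f \<in> hom_set SET X Y" "g \<in> hom_set SET Y Z" "t \<in> elts (onObj G X)"
  shows "app (onArr G (g \<cdot>\<^bsub>SET\<^esub> f)) t = app (onArr G g) (app (onArr G f) t)"
  using app_Comp[OF G.arr[OF assms(1)] assms(3)] G.comp[OF assms(1,2)] by metis

text \<open>The characteristic map of \<open>preimage f B\<close> passes through \<open>Y\<close>.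
  Both \<open>Y\<close> and \<open>truth_values\<close> are finite, so naturality of
  \<open>\<alpha>\<close> applies to \<open>char_map Y B\<close> and yields a direct image, which
  contains only \<open>truth\<close> iff it comes from elements of \<open>B\<close>. The set
  \<open>X\<close> may be infinite.\<close>

lemma preimage_key:
  assumes f: "f \<in> hom_set SET X Y" and fin: "finite (elts Y)" and B: "elts B \<subseteq> elts Y"
    and t: "t \<in> elts (onObj G X)"
  shows "elts (app (\<alpha> truth_values) (app (onArr G (char_map X (preimage f B))) t)) \<subseteq> {truth} \<longleftrightarrow>
    elts (app (\<alpha> Y) (app (onArr G f) t)) \<subseteq> elts B"
proof -
  let ?s = "app (onArr G f) t"
  have s: "?s \<in> elts (onObj G Y)"
    by (rule hom_SETD(3)[OF G.arr[OF f] t])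
  have "app (onArr G (char_map X (preimage f B))) t = app (onArr G (char_map Y B)) ?s"
    unfolding char_map_preimage[OF f] by (rule G_Comp[OF f char_map_hom t])
  moreover have "elts (app (\<alpha> truth_values) (app (onArr G (char_map Y B)) ?s)) =
      app (char_map Y B) ` elts (app (\<alpha> Y) ?s)"
    by (rule component_map[OF char_map_hom fin _ s]) simp
  moreover have "app (char_map Y B) y = truth \<longleftrightarrow> y \<in> elts B" if "y \<in> elts (app (\<alpha> Y) ?s)" for y
    using subsetD[OF component_subset[OF fin s] that] by (auto simp: char_map_def)
  ultimately show ?thesis by auto
qed

lemma kan_map_hom: "kan_map G \<alpha> X \<in> hom_set SET (onObj G X) (filter_obj X)"
  unfolding kan_map_def
proof (intro mk_map_hom filter_objI)
  fix t assume t: "t \<in> elts (onObj G X)"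
  have fin: "finite (elts (truth_values :: 'v))" "finite (elts (pow_obj truth_values :: 'v))"
    by auto
  let ?P = "\<lambda>A. elts (app (\<alpha> truth_values) (app (onArr G (char_map X A)) t)) \<subseteq> {truth}"
  \<comment> \<open>\<open>X\<close> is the inverse image of all of \<open>truth_values\<close>, and
    every value of \<open>\<alpha> truth_values\<close> is contained in that set.\<close>
  have "preimage (char_map X X) truth_values = X"
    using hom_SETD[OF char_map_hom[of X X]] by (auto intro!: extensionality)
  then show "?P X"
    using preimage_key[OF char_map_hom fin(1) subset_refl t, of X]
      component_subset[OF fin(1) hom_SETD(3)[OF G.arr[OF char_map_hom] t]] by metis
  fix A B assume A: "elts A \<subseteq> elts X" and B: "elts B \<subseteq> elts X"
  \<comment> \<open>The pairing of the characteristic maps of \<open>A\<close> and \<open>B\<close>,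
    with P(2) in place of the product 2 x 2: membership of \<open>truth\<close> in the value records
    \<open>A\<close>, membership of \<open>code {}\<close> records \<open>B\<close>.\<close>
  define f where "f = mk_map X (pow_obj truth_values)
    (\<lambda>x. code {z \<in> elts truth_values. x \<in> elts (if z = truth then A else B)})"
  have f: "f \<in> hom_set SET X (pow_obj truth_values)"
    unfolding f_def by (rule mk_map_hom, unfold elts_pow_obj mem_Collect_eq elts_code_Collect, blast)
  \<comment> \<open>The subsets of 2 containing \<open>z\<close>, that is, where the coordinate
    \<open>z\<close> holds; their inverse images under \<open>f\<close> are \<open>A\<close> and
    \<open>B\<close>.\<close>
  define U where "U z = code {S. elts S \<subseteq> elts truth_values \<and> z \<in> elts S}" for z :: 'v
  have U: "elts (U z) = {S. elts S \<subseteq> elts truth_values \<and> z \<in> elts S}" for z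
    unfolding U_def by (rule elts_code_subsets)
  have Usub: "elts (U z) \<subseteq> elts (pow_obj truth_values)" for z
    unfolding U elts_pow_obj by (rule Collect_mono, rule impI, rule conjunct1)
  have fU: "preimage f (U z) = (if z = truth then A else B)" if z: "z \<in> elts truth_values" for z
  proof (rule extensionality, rule set_eqI)
    fix x
    have "app f x \<in> elts (U z) \<longleftrightarrow> x \<in> elts (if z = truth then A else B)" if "x \<in> elts X"
      unfolding f_def app_mk_map[OF that] U mem_Collect_eq elts_code_Collect using z by blast
    then show "x \<in> elts (preimage f (U z)) \<longleftrightarrow> x \<in> elts (if z = truth then A else B)"
      unfolding elts_code_Collect hom_SETD(1)[OF f] using A B by (cases "z = truth") auto
  qed
  let ?S = "app (\<alpha> (pow_obj truth_values)) (app (onArr G f) t)"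
  have tv: "truth \<in> elts truth_values" "code {} \<in> elts truth_values"
    by simp_all
  have fA: "preimage f (U truth) = A"
    using fU[OF tv(1)] by (simp only: if_True simp_thms)
  have fB: "preimage f (U (code {})) = B"
    using fU[OF tv(2)] by (simp only: empty_neq_truth if_False)
  have fAB: "preimage f (code (elts (U truth) \<inter> elts (U (code {})))) = code (elts A \<inter> elts B)"
    unfolding preimage_Int fA fB ..
  have Isub: "elts (code (elts (U truth) \<inter> elts (U (code {})))) \<subseteq> elts (pow_obj truth_values)"
    unfolding elts_code_Int using Usub[of truth] by (rule le_infI1)
  \<comment> \<open>All three conditions now concern the single set \<open>?S\<close>, and lying in
    an intersection means lying in both parts.\<close>
  have "?P A \<longleftrightarrow> elts ?S \<subseteq> elts (U truth)"
    using preimage_key[OF f fin(2) Usub t, of truth] unfolding fA .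
  moreover have "?P B \<longleftrightarrow> elts ?S \<subseteq> elts (U (code {}))"
    using preimage_key[OF f fin(2) Usub t, of "code {}"] unfolding fB .
  moreover have "?P (code (elts A \<inter> elts B)) \<longleftrightarrow> elts ?S \<subseteq> elts (U truth) \<inter> elts (U (code {}))"
    using preimage_key[OF f fin(2) Isub t, unfolded fAB] unfolding elts_code_Int .
  ultimately show "?P (code (elts A \<inter> elts B)) \<longleftrightarrow> ?P A \<and> ?P B"
    by (simp only: le_inf_iff)
qed

lemma mem_kan_map:
  assumes "t \<in> elts (onObj G X)"
  shows "A \<in> elts (app (kan_map G \<alpha> X) t) \<longleftrightarrow> elts A \<subseteq> elts X \<and>
    elts (app (\<alpha> truth_values) (app (onArr G (char_map X A)) t)) \<subseteq> {truth}"
  using assms by (simp add: kan_map_def)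

lemma kan_map_nat_trans: "nat_trans SET SET G (Fun filter_monad) (kan_map G \<alpha>)"
proof unfold_locales
  show "kan_map G \<alpha> X \<in> hom_set SET (onObj G X) (onObj (Fun filter_monad) X)" for X
    using kan_map_hom by simp
next
  fix f :: "'v setmap" and X Y assume f: "f \<in> hom_set SET X Y"
  note K = kan_map_hom and Ff = filter_map_hom[OF f] and Gf = G.arr[OF f]
  have "filter_map f \<cdot>\<^bsub>SET\<^esub> kan_map G \<alpha> X = kan_map G \<alpha> Y \<cdot>\<^bsub>SET\<^esub> onArr G f"
  proof (rule hom_SET_eqI[OF SET.comp_hom[OF K Ff] SET.comp_hom[OF Gf K]])
    fix t assume t: "t \<in> elts (onObj G X)"
    have "B \<in> elts (app (filter_map f) (app (kan_map G \<alpha> X) t)) \<longleftrightarrow>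
        B \<in> elts (app (kan_map G \<alpha> Y) (app (onArr G f) t))" for B
    proof -
      have "elts (preimage f B) \<subseteq> elts X"
        using hom_SETD(1)[OF f] by auto
      then show ?thesis
        unfolding mem_filter_map[OF f hom_SETD(3)[OF K t]] mem_kan_map[OF t]
          mem_kan_map[OF hom_SETD(3)[OF Gf t]] char_map_preimage[OF f] G_Comp[OF f char_map_hom t]
        by blast
    qed
    then show "app (filter_map f \<cdot>\<^bsub>SET\<^esub> kan_map G \<alpha> X) t = app (kan_map G \<alpha> Y \<cdot>\<^bsub>SET\<^esub> onArr G f) t"
      unfolding app_Comp[OF K t] app_Comp[OF Gf t] by (blast intro: extensionality)
  qed
  then show "onArr (Fun filter_monad) f \<cdot>\<^bsub>SET\<^esub> kan_map G \<alpha> X = kan_map G \<alpha> Y \<cdot>\<^bsub>SET\<^esub> onArr G f"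
    by (simp only: filter_monad_simps)
qed

text \<open>With the identity of \<open>X\<close> in \<open>preimage_key\<close>, the comparison
  filter at \<open>t\<close> is the principal filter of \<open>\<alpha> X\<close> at
  \<open>t\<close>, whose core is known.\<close>

lemma kan_map_factor:
  assumes fin: "finite (elts X)"
  shows "filter_core X \<cdot>\<^bsub>SET\<^esub> kan_map G \<alpha> X = \<alpha> X"
proof (rule hom_SET_eqI[OF SET.comp_hom[OF kan_map_hom filter_core_hom] component_hom[OF fin]])
  fix t assume t: "t \<in> elts (onObj G X)"
  have I: "mk_map X X (\<lambda>x. x) \<in> hom_set SET X X"
    by (rule mk_map_hom)
  have "app (onArr G (mk_map X X (\<lambda>x. x))) t = t"
    using G.ident[of X] t by simp
  moreover have "preimage (mk_map X X (\<lambda>x. x)) B = B" if "elts B \<subseteq> elts X" for B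
    using that by (auto simp: subset_iff intro!: extensionality)
  ultimately have "app (filter_core X) (app (kan_map G \<alpha> X) t) = app (\<alpha> X) t"
    using fin hom_SETD(3)[OF kan_map_hom t] component_subset[OF fin t] preimage_key[OF I fin _ t]
    by (intro filter_core_eqI) (simp_all add: mem_kan_map[OF t])
  then show "app (filter_core X \<cdot>\<^bsub>SET\<^esub> kan_map G \<alpha> X) t = app (\<alpha> X) t"
    unfolding app_Comp[OF kan_map_hom t] .
qed

text \<open>Naturality of \<open>\<beta>\<close> at a characteristic map moves the question whether
  \<open>A\<close> is a member to \<open>truth_values\<close>. That set is finite, so the filter
  there is determined by its core, which the factorisation fixes.\<close>

lemma kan_map_unique:
  assumes \<beta>: "nat_trans SET SET G (Fun filter_monad) \<beta>"
    and factor: "\<And>X. finite (elts X) \<Longrightarrow> filter_core X \<cdot>\<^bsub>SET\<^esub> \<beta> X = \<alpha> X"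
  shows "\<beta> Y = kan_map G \<alpha> Y"
proof -
  interpret \<beta>: nat_trans SET SET G "Fun filter_monad" \<beta> by fact
  have \<beta>_hom: "\<beta> X \<in> hom_set SET (onObj G X) (filter_obj X)" for X
    using \<beta>.component[of X] by simp
  show ?thesis
  proof (rule hom_SET_eqI[OF \<beta>_hom kan_map_hom])
    fix t assume t: "t \<in> elts (onObj G Y)"
    note \<beta>t = hom_SETD(3)[OF \<beta>_hom t]
    show "app (\<beta> Y) t = app (kan_map G \<alpha> Y) t"
    proof (rule filter_obj_eqI[OF \<beta>t hom_SETD(3)[OF kan_map_hom t]])
      fix A assume A: "elts A \<subseteq> elts Y"
      let ?c = "char_map Y A"
      let ?s = "app (onArr G ?c) t"
      have c: "?c \<in> hom_set SET Y truth_values" and s: "?s \<in> elts (onObj G truth_values)"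
        using char_map_hom hom_SETD(3)[OF G.arr[OF char_map_hom] t] by auto
      have fin: "finite (elts (truth_values :: 'v))"
        by simp
      \<comment> \<open>The test set on \<open>truth_values\<close>: its inverse image under the
        characteristic map is \<open>A\<close>.\<close>
      define T :: 'v where "T = code {truth}"
      have T: "elts T = {truth}" and Tsub: "elts T \<subseteq> elts truth_values"
        by (simp_all add: T_def)
      have "preimage ?c T = A"
        using A hom_SETD(1)[OF c]
        by (auto simp: char_map_def T subset_iff split: if_splits intro!: extensionality)
      then have "A \<in> elts (app (\<beta> Y) t) \<longleftrightarrow> T \<in> elts (app (filter_map ?c) (app (\<beta> Y) t))"
        using Tsub by (simp only: mem_filter_map[OF c \<beta>t] simp_thms)
      also have "app (filter_map ?c) (app (\<beta> Y) t) = app (\<beta> truth_values) ?s"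
        using \<beta>.naturality[OF c] app_Comp[OF \<beta>_hom t, of "filter_map ?c"]
          app_Comp[OF G.arr[OF c] t, of "\<beta> truth_values"] unfolding filter_monad_simps by metis
      also have "T \<in> elts \<dots> \<longleftrightarrow>
          elts (app (filter_core truth_values) (app (\<beta> truth_values) ?s)) \<subseteq> elts T"
        by (rule mem_iff_filter_core[OF fin hom_SETD(3)[OF \<beta>_hom s] Tsub])
      also have "app (filter_core truth_values) (app (\<beta> truth_values) ?s) = app (\<alpha> truth_values) ?s"
        using app_Comp[OF \<beta>_hom s] factor[OF fin] by metis
      finally show "A \<in> elts (app (\<beta> Y) t) \<longleftrightarrow> A \<in> elts (app (kan_map G \<alpha> Y) t)"
        using A by (simp add: mem_kan_map[OF t] T)
    qed
  qed
qed

end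

lemma filter_right_kan_extension:
  "right_kan_extension FINSET SET SET fin_inclusion (fin_inclusion \<circ>\<^sub>F Fun powerset_monad)
     (Fun filter_monad) filter_core"
  unfolding right_kan_extension_def
proof (intro conjI allI impI)
  show "is_functor FINSET SET fin_inclusion" by unfold_locales
  then show "is_functor FINSET SET (fin_inclusion \<circ>\<^sub>F Fun powerset_monad)"
    by (rule is_functor_comp[rotated]) unfold_locales
  show "is_functor SET SET (Fun filter_monad)" by unfold_locales
  show "nat_trans FINSET SET (Fun filter_monad \<circ>\<^sub>F fin_inclusion)
      (fin_inclusion \<circ>\<^sub>F Fun powerset_monad) filter_core"
    by (rule filter_core_nat_trans)
  fix G :: "('a, 'a setmap, 'a, 'a setmap) func" and \<alpha>
  assume "is_functor SET SET G \<and>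
    nat_trans FINSET SET (G \<circ>\<^sub>F fin_inclusion) (fin_inclusion \<circ>\<^sub>F Fun powerset_monad) \<alpha>"
  then interpret kan_competitor G \<alpha>
    by (simp add: kan_competitor_def)
  show "\<exists>\<beta>. nat_trans SET SET G (Fun filter_monad) \<beta> \<and>
      (\<forall>X \<in> Obj FINSET. filter_core X \<cdot>\<^bsub>SET\<^esub> \<beta> (onObj fin_inclusion X) = \<alpha> X) \<and>
      (\<forall>\<beta>'. nat_trans SET SET G (Fun filter_monad) \<beta>' \<and>
        (\<forall>X \<in> Obj FINSET. filter_core X \<cdot>\<^bsub>SET\<^esub> \<beta>' (onObj fin_inclusion X) = \<alpha> X) \<longrightarrow>
        (\<forall>Y \<in> Obj SET. \<beta>' Y = \<beta> Y))"
    unfolding fin_inclusion_simps Obj_FINSET mem_Collect_eq Ball_def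
    using kan_map_nat_trans kan_map_factor kan_map_unique by blast
qed

lemma filter_pushforward: "pushforward FINSET SET fin_inclusion powerset_monad filter_monad filter_core"
  unfolding pushforward_def
proof (intro conjI ballI)
  show "monad FINSET powerset_monad" "monad SET filter_monad" by unfold_locales
  fix X :: 'a assume "X \<in> Obj FINSET"
  then have fin: "finite (elts X)" by simp
  show "filter_core X \<cdot>\<^bsub>SET\<^esub> unit filter_monad (onObj fin_inclusion X) =
      onArr fin_inclusion (unit powerset_monad X)"
    using filter_core_unit[OF fin] by (simp only: fin_inclusion_simps filter_monad_simps)
  show "filter_core X \<cdot>\<^bsub>SET\<^esub> mult filter_monad (onObj fin_inclusion X) =
      onArr fin_inclusion (mult powerset_monad X) \<cdot>\<^bsub>SET\<^esub>
        filter_core (onObj (Fun powerset_monad) X) \<cdot>\<^bsub>SET\<^esub> onArr (Fun filter_monad) (filter_core X)"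
    using filter_core_mult[OF fin]
    by (simp only: fin_inclusion_simps filter_monad_simps powerset_monad_simps(1))
qed (rule filter_right_kan_extension)

text \<open>Since \<open>pushforward\<close> is a predicate, the existence clause keeps the
  isomorphism clause from being vacuous. The filter monad with counit \<open>filter_core\<close> is
  the witness, and uniqueness compares every other pushforward with it.\<close>

theorem theorem3p10:
  shows "(\<exists>(R :: ('v::universe, 'v setmap) monad_data) \<epsilon>.
      pushforward FINSET SET fin_inclusion powerset_monad R \<epsilon>) \<and>
    (\<forall>(R :: ('v, 'v setmap) monad_data) \<epsilon>.
      pushforward FINSET SET fin_inclusion powerset_monad R \<epsilon> \<longrightarrow>
      monads_isomorphic SET R filter_monad)"
  using filter_pushforward pushforward_unique by blast

end
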